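(* Let $m\geqslant 2$, $n\geqslant 1$, let $\mathbf{k}$ be a differential field of characteristic zero with $m$ commuting derivations $\partial_1,\dots,\partial_m$, and let $Y=\{y_1,\dots,y_n\}$ be differential indeterminates. Let $F,K\subseteq\mathbf{k}\{Y\}$ be finite subsets with $h=\mathcal{H}(F\cup K)$. Let $w(\partial_1^{i_1}\cdots\partial_m^{i_m})=c_1i_1+\cdots+c_mi_m$ (with $c_1,\dots,c_m$ positive integers) be a weight on $\Theta$ such that $\mathcal{W}(F\cup K)=\mathcal{H}(F\cup K)$, and fix a weighted ranking on $\Theta Y$ with respect to $w$. Let $\{f_0,f_1,f_2,\dots\}=\{0,1,1,2,3,5,\dots\}$ be the Fibonacci sequence, and let $\{f(n,h)_k\}_{k\geqslant 0}$ be defined by $$\begin{cases} f(n,h)_0=0,\quad f(n,h)_1=f(n,h)_2=h,\\ f(n,h)_k=f(n,h)_{k-1}+f(n,h)_{k-2} & \text{for } 3\leqslant k\leqslant n+1,\\ f(n,h)_k=f(n,h)_{k-1}+f(n,h)_{k-2}-1 & \text{for } k\geqslant 3,\ k>n+1.\end{cases}$$ Put $f(i)=f(n,h)_i$ if $m=2$ and $f(i)=hf_i$ if $m>2$, let $L=\mathfrak{L}^n_{f,m}$, and let $\mathcal{A}=\textsf{Rosenfeld-Gröbner}(F,K)$. Then for every $(A,H)\in\mathcal{A}$, every $g\in A\cup H$ and every $i$, $1\leqslant i\leqslant m$, $$\mathrm{ord}(g,\partial_i)\leqslant\begin{cases}\dfrac{f(n,h)_{L+1}}{c_i} & \text{if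 } m=2,\\[2mm] \dfrac{hf_{L+1}}{c_i} & \text{if } m>2.\end{cases}$$
   Context: Differential algebra. $\mathbf{k}$ is a differential field of characteristic zero with commuting derivations $\Delta=\{\partial_1,\dots,\partial_m\}$; $\Theta=\{\partial_1^{i_1}\cdots\partial_m^{i_m}: i_j\in\mathbb{Z}_{\geqslant 0}\}$; $\Theta Y=\{\theta y:\theta\in\Theta,y\in Y\}$; $\mathbf{k}\{Y\}=\mathbf{k}[\theta y:\theta y\in\Theta Y]$ with the natural derivations. The order of $\partial_1^{i_1}\cdots\partial_m^{i_m}y$ is $i_1+\cdots+i_m$; its weight is $w(\partial_1^{i_1}\cdots\partial_m^{i_m}y)=c_1i_1+\cdots+c_mi_m$. For $f\in\mathbf{k}\{Y\}\setminus\mathbf{k}$, $\mathrm{ord}(f)$ (resp. $w(f)$) is the maximum order (resp. weight) of the derivatives appearing in $f$; for $f\in\mathbf{k}$ both are $0$. $\mathrm{ord}(g,\partial_i)$ is the maximal exponent of $\partial_i$ among the derivatives appearing in $g$ ($0$ if $g\in\mathbf{k}$). For a finite set $A$, $\mathcal{H}(A)=\max\{\mathrm{ord}(f):f\in A\}$ and $\mathcal{W}(A)=\max\{w(f):f\in A\}$, both being $0$ for $A=\varnothing$. A ranking is a total order $<$ on $\Theta Y$ with $u<\theta u$ and $u<v\Rightarrow\theta u<\theta v$ for all $u,v\in\Theta Y$ and $\theta\in\Theta$, $\theta\neq\mathrm{id}$; it is a weighted ranking if $w(u)<w(v)$ implies $u<v$. For $f\in\mathbf{k}\{Y\}\setminus\mathbf{k}$: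 the leader $\mathrm{lead}(f)$ is the highest-ranked derivative in $f$; the initial $\mathrm{init}(f)$ is the leading coefficient of $f$ as a univariate polynomial in $\mathrm{lead}(f)$; the separant $\mathrm{sep}(f)$ is the initial of $\delta f$ for any $\delta\in\Delta$ (i.e. $\partial f/\partial\,\mathrm{lead}(f)$); $\mathrm{rank}(f)=\mathrm{lead}(f)^d$ with $d=\deg_{\mathrm{lead}(f)}(f)$, ranks being compared first by leader, then by $d$. For a set $A\subseteq\mathbf{k}\{Y\}\setminus\mathbf{k}$: $\mathfrak{L}(A)$ is its set of leaders, $S_A$ its set of separants, $H_A$ its set of initials and separants. $f$ is partially reduced with respect to $g$ if no proper derivative of $\mathrm{lead}(g)$ appears in $f$; it is reduced if moreover $\deg_{\mathrm{lead}(g)}(f)<\deg_{\mathrm{lead}(g)}(g)$; (partially) reduced with respect to a set means with respect to all its elements. $A$ is autoreduced if each element is reduced with respect to every other, and weak d-triangular if $\mathfrak{L}(A)$ is autoreduced (then distinct elements have distinct leaders, and $A_u$ denotes the element with leader $u$). $S^\infty$ is the multiplicative set generated by $S$ and $1$; $[A]$ is the differential ideal generated by $A$. For $A$ weak d-triangular, $\mathrm{pd\text{-}red}(f,A)$ (resp. $\mathrm{d\text{-}red}(f,A)$) is a polynomial $f_1$ partially reduced (resp. $f_2$ reduced) with respect to $A$, with $sf\equiv f_1 \bmod [A]$ for some $s\in S_A^\infty$ (resp. $hf\equiv f_2\bmod[A]$ for some $h\in H_A^\infty$), computed by fixed (standard) algorithms that never increase rank, hence never increase weight. If $u=\partial_1^{i_1}\cdots\partial_m^{i_m}y$,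 $v=\partial_1^{j_1}\cdots\partial_m^{j_m}y$ with the same $y\in Y$, then $\mathrm{lcd}(u,v)=\partial_1^{\max(i_1,j_1)}\cdots\partial_m^{\max(i_m,j_m)}y$. $\Delta(f,g)=0$ if $\mathrm{lead}(f),\mathrm{lead}(g)$ are derivatives of different elements of $Y$; otherwise $\Delta(f,g)=\mathrm{sep}(g)\phi(f)-\mathrm{sep}(f)\psi(g)$, where $\phi,\psi\in\Theta$ satisfy $\phi(\mathrm{lead}(f))=\psi(\mathrm{lead}(g))=\mathrm{lcd}(\mathrm{lead}(f),\mathrm{lead}(g))$. The algorithm. $\textsf{Rosenfeld-Gröbner}(F,K)$ maintains a set $\mathcal{S}$ of 4-tuples $(G,D,A,H)$ of finite subsets of $\mathbf{k}\{Y\}$ ($A$ weak d-triangular), initially $\mathcal{S}=\{(F,\varnothing,\varnothing,K)\}$, and an output set $\mathcal{A}$, initially empty. While $\mathcal{S}\neq\varnothing$: remove some $(G,D,A,H)$ from $\mathcal{S}$. If $G\cup D=\varnothing$, replace $\mathcal{A}$ by $\mathcal{A}\cup\textsf{auto-partial-reduce}(A,H)$. Otherwise choose $p\in G\cup D$, put $\bar G=G\setminus\{p\}$, $\bar D=D\setminus\{p\}$, $\bar p=\mathrm{d\text{-}red}(p,A)$. If $\bar p=0$, add $(\bar G,\bar D,A,H)$ to $\mathcal{S}$. If $\bar p\in\mathbf{k}\setminus\{0\}$, add nothing. If $\bar p\notin\mathbf{k}$, put $\bar p_i=\bar p-\mathrm{init}(\bar p)\,\mathrm{rank}(\bar p)$,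 $\bar p_s=\deg_{\mathrm{lead}(\bar p)}(\bar p)\,\bar p-\mathrm{lead}(\bar p)\,\mathrm{sep}(\bar p)$ and add to $\mathcal{S}$ the three tuples $\textsf{update}(\bar G,\bar D,A,H,\bar p)$, $(\bar G\cup\{\bar p_s,\mathrm{sep}(\bar p)\},\bar D,A,H\cup\{\mathrm{init}(\bar p)\})$, $(\bar G\cup\{\bar p_i,\mathrm{init}(\bar p)\},\bar D,A,H)$. When $\mathcal{S}=\varnothing$, return $\mathcal{A}$. $\textsf{update}(G,D,A,H,p)$: with $u=\mathrm{lead}(p)$, $G_A=\{a\in A:\mathrm{lead}(a)\in\Theta u\}$, $\bar A=A\setminus G_A$, return $\bigl(G\cup G_A,\ (D\cup\{\Delta(p,a):a\in\bar A\})\setminus\{0\},\ \bar A\cup\{p\},\ H\cup\{\mathrm{sep}(p),\mathrm{init}(p)\}\bigr)$. $\textsf{auto-partial-reduce}(A,H)$: start with $B=\varnothing$; for $u\in\mathfrak{L}(A)$ in increasing order, let $b=\mathrm{pd\text{-}red}(A_u,B)$; if $\mathrm{rank}(b)=\mathrm{rank}(A_u)$ add $b$ to $B$, otherwise return $\varnothing$. Then let $K'=H_B\cup\{\mathrm{pd\text{-}red}(q,B):q\in H\setminus H_A\}$; return $\varnothing$ if $0\in K'$, otherwise return $\{(B,K')\}$. Antichain lengths. Let $\mathfrak{n}=\{1,\dots,n\}$. On $\mathbb{Z}_{\geqslant 0}^m\times\mathfrak{n}$ let $((i_1,\dots,i_m),k)\preccurlyeq((j_1,\dots,j_m),l)$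 iff $k=l$ and $i_r\leqslant j_r$ for all $r$; the degree of $((i_1,\dots,i_m),k)$ is $i_1+\cdots+i_m$. An antichain sequence is a sequence $s_1,s_2,\dots$ of pairwise incomparable elements (all such sequences are finite). A function $f$ on $\mathbb{Z}_{>0}$ bounds its degree growth if $\deg(s_i)\leqslant f(i)$ for every term $s_i$. $\mathfrak{L}^n_{f,m}$ denotes the maximal length of an antichain sequence of $\mathbb{Z}_{\geqslant 0}^m\times\mathfrak{n}$ with degree growth bounded by $f$ (this maximum exists). *)

theory Defs
  imports "HOL-Library.Poly_Mapping" "HOL-Library.Cardinality" "HOL-Number_Theory.Fib"
begin

section \<open>Differential polynomials\<close>

text \<open>
  The derivations are indexed by a finite type \<open>'m\<close> and the differential indeterminates by a
  finite type \<open>'n\<close>. An element of \<open>\<Theta>\<close> is its exponent function, so that \<open>\<Theta>Y\<close> is the type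
  \<open>('m, 'n) dvar\<close>. As a set this is also the product ordering used for antichain sequences.
  Differential polynomials are finitely supported functions from monomials
  to coefficients, with the ring structure of \<open>HOL-Library.Poly_Mapping\<close>.
\<close>

type_synonym 'm theta = "'m \<Rightarrow> nat"
type_synonym ('m, 'n) dvar = "('m \<Rightarrow> nat) \<times> 'n"
type_synonym ('m, 'n, 'k) dpoly = "(('m, 'n) dvar \<Rightarrow>\<^sub>0 nat) \<Rightarrow>\<^sub>0 'k"

definition differential_field :: "('m \<Rightarrow> 'k::field \<Rightarrow> 'k) \<Rightarrow> bool" where
  "differential_field d \<longleftrightarrow>
     (\<forall>i a b. d i (a + b) = d i a + d i b) \<and>
     (\<forall>i a b. d i (a * b) = d i a * b + a * d i b) \<and>
     (\<forall>i j a. d i (d j a) = d j (d i a))"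

definition theta_var :: "'m theta \<Rightarrow> ('m, 'n) dvar \<Rightarrow> ('m, 'n) dvar" where
  "theta_var \<theta> v = (\<lambda>i. \<theta> i + fst v i, snd v)"

definition Const :: "'k::comm_ring_1 \<Rightarrow> ('m, 'n, 'k) dpoly" where
  "Const a = Poly_Mapping.single 0 a"

definition Var :: "('m, 'n) dvar \<Rightarrow> ('m, 'n, 'k::comm_ring_1) dpoly" where
  "Var v = Poly_Mapping.single (Poly_Mapping.single v 1) 1"

definition ground :: "('m, 'n, 'k::comm_ring_1) dpoly set" where
  "ground = {Const a | a. True}"

definition vars :: "('m, 'n, 'k::comm_ring_1) dpoly \<Rightarrow> ('m, 'n) dvar set" where
  "vars f = (\<Union>\<mu>\<in>Poly_Mapping.keys f. Poly_Mapping.keys \<mu>)"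

definition deg_in :: "('m, 'n) dvar \<Rightarrow> ('m, 'n, 'k::comm_ring_1) dpoly \<Rightarrow> nat" where
  "deg_in v f = Max (insert 0 ((\<lambda>\<mu>. Poly_Mapping.lookup \<mu> v) ` Poly_Mapping.keys f))"

text \<open>The coefficient of \<open>v ^ e\<close> in \<open>f\<close>, viewed as a univariate polynomial in \<open>v\<close>.\<close>

definition coeff_in :: "('m, 'n) dvar \<Rightarrow> nat \<Rightarrow> ('m, 'n, 'k::comm_ring_1) dpoly \<Rightarrow> ('m, 'n, 'k) dpoly" where
  "coeff_in v e f =
     (\<Sum>\<mu> | \<mu> \<in> Poly_Mapping.keys f \<and> Poly_Mapping.lookup \<mu> v = e.
        Poly_Mapping.single (\<mu> - Poly_Mapping.single v e) (Poly_Mapping.lookup f \<mu>))"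

definition partial_deriv :: "('m, 'n) dvar \<Rightarrow> ('m, 'n, 'k::comm_ring_1) dpoly \<Rightarrow> ('m, 'n, 'k) dpoly" where
  "partial_deriv v f =
     (\<Sum>\<mu>\<in>Poly_Mapping.keys f.
        Poly_Mapping.single (\<mu> - Poly_Mapping.single v 1)
          (of_nat (Poly_Mapping.lookup \<mu> v) * Poly_Mapping.lookup f \<mu>))"

text \<open>
  The derivation \<open>\<partial>\<^sub>i\<close> on differential polynomials: apply \<open>d i\<close> to the coefficients, and
  use the chain rule for the derivatives that occur.
\<close>

definition deriv_poly ::
    "('m \<Rightarrow> 'k \<Rightarrow> 'k) \<Rightarrow> 'm \<Rightarrow> ('m, 'n, 'k::comm_ring_1) dpoly \<Rightarrow> ('m, 'n, 'k) dpoly" where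
  "deriv_poly d i f =
     Poly_Mapping.map (d i) f +
     (\<Sum>v\<in>vars f. partial_deriv v f * Var (theta_var (\<lambda>j. if j = i then 1 else 0) v))"

text \<open>
  The order in which the fold runs through the derivations is irrelevant, as they commute;
  see \<open>comp_fun_commute_deriv_poly\<close> below.
\<close>

definition theta_poly ::
    "('m \<Rightarrow> 'k \<Rightarrow> 'k) \<Rightarrow> 'm theta \<Rightarrow> ('m::finite, 'n, 'k::comm_ring_1) dpoly \<Rightarrow> ('m, 'n, 'k) dpoly" where
  "theta_poly d \<theta> f = Finite_Set.fold (\<lambda>i. deriv_poly d i ^^ \<theta> i) f UNIV"

inductive_set diff_ideal ::
    "('m \<Rightarrow> 'k \<Rightarrow> 'k) \<Rightarrow> ('m, 'n, 'k::comm_ring_1) dpoly set \<Rightarrow> ('m, 'n, 'k) dpoly set"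
  for d A where
  zero: "0 \<in> diff_ideal d A"
| base: "f \<in> A \<Longrightarrow> f \<in> diff_ideal d A"
| add: "f \<in> diff_ideal d A \<Longrightarrow> g \<in> diff_ideal d A \<Longrightarrow> f + g \<in> diff_ideal d A"
| mult: "f \<in> diff_ideal d A \<Longrightarrow> q * f \<in> diff_ideal d A"
| deriv: "f \<in> diff_ideal d A \<Longrightarrow> deriv_poly d i f \<in> diff_ideal d A"

inductive_set mult_closure :: "'a::comm_ring_1 set \<Rightarrow> 'a set" for S where
  one: "1 \<in> mult_closure S"
| mult: "s \<in> S \<Longrightarrow> t \<in> mult_closure S \<Longrightarrow> s * t \<in> mult_closure S"


subsection \<open>The derivations extend those of the field and commute\<close>

lemma additive_zero:
  fixes \<delta> :: "'k::comm_ring_1 \<Rightarrow> 'k"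
  assumes "\<And>a b. \<delta> (a + b) = \<delta> a + \<delta> b"
  shows "\<delta> 0 = 0"
proof -
  have "\<delta> 0 + 0 = \<delta> 0 + \<delta> 0" using assms[of 0 0] unfolding add_0_right .
  then show ?thesis by (rule add_left_imp_eq[symmetric])
qed

lemma map_coeffs_add:
  fixes \<delta> :: "'k::comm_ring_1 \<Rightarrow> 'k"
  assumes "\<And>a b. \<delta> (a + b) = \<delta> a + \<delta> b"
  shows "Poly_Mapping.map \<delta> (f + g :: 'a \<Rightarrow>\<^sub>0 'k) = Poly_Mapping.map \<delta> f + Poly_Mapping.map \<delta> g"
proof -
  have z: "\<delta> 0 = 0" using assms by (rule additive_zero)
  have l: "Poly_Mapping.lookup (Poly_Mapping.map \<delta> p) k = \<delta> (Poly_Mapping.lookup p k)" for p :: "'a \<Rightarrow>\<^sub>0 'k" and k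
    by (simp add: Poly_Mapping.map.rep_eq when_def z)
  show ?thesis
    by (rule poly_mapping_eqI) (simp only: l lookup_add assms)
qed

lemma vars_finite [simp]: "finite (vars f)" by (simp add: vars_def)

lemma partial_deriv_superset:
  assumes "finite U" "Poly_Mapping.keys f \<subseteq> U"
  shows "partial_deriv v f = (\<Sum>\<mu>\<in>U. Poly_Mapping.single (\<mu> - Poly_Mapping.single v 1)
          (of_nat (Poly_Mapping.lookup \<mu> v) * Poly_Mapping.lookup f \<mu>))"
  unfolding partial_deriv_def using assms
  by (intro sum.mono_neutral_left) (auto simp: in_keys_iff)

lemma partial_deriv_add: "partial_deriv v (f + g) = partial_deriv v f + partial_deriv v g"
proof -
  let ?U = "Poly_Mapping.keys f \<union> Poly_Mapping.keys g"
  have "Poly_Mapping.keys (f + g) \<subseteq> ?U" by (rule keys_add)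
  then show ?thesis
    by (simp add: partial_deriv_superset[where U="?U"] lookup_add distrib_left single_add
        sum.distrib)
qed

lemma partial_deriv_eq_0: "v \<notin> vars f \<Longrightarrow> partial_deriv v f = 0"
  unfolding partial_deriv_def by (rule sum.neutral) (auto simp: vars_def in_keys_iff)

lemma deriv_poly_superset:
  assumes "finite V" "vars f \<subseteq> V"
  shows "deriv_poly d i f = Poly_Mapping.map (d i) f +
     (\<Sum>v\<in>V. partial_deriv v f * Var (theta_var (\<lambda>j. if j = i then 1 else 0) v))"
  unfolding deriv_poly_def using assms
  by (intro arg_cong2[where f="(+)"] refl sum.mono_neutral_left) (auto simp: partial_deriv_eq_0)

lemma vars_add: "vars (f + g) \<subseteq> vars f \<union> vars g"
  unfolding vars_def using keys_add by fastforce

lemma deriv_poly_add: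
  assumes "differential_field d"
  shows "deriv_poly d i (f + g) = deriv_poly d i f + deriv_poly d i g"
proof -
  let ?V = "vars f \<union> vars g"
  have "vars (f + g) \<subseteq> ?V" by (rule vars_add)
  then show ?thesis using assms
    by (simp add: deriv_poly_superset[where V="?V"] partial_deriv_add distrib_right sum.distrib
        map_coeffs_add differential_field_def)
qed

lemma poly_sum: "f = (\<Sum>\<mu>\<in>Poly_Mapping.keys f. Poly_Mapping.single \<mu> (Poly_Mapping.lookup f \<mu>))"
  by (rule poly_mapping_eqI) (auto simp: lookup_sum lookup_single when_def in_keys_iff)

lemma mono_sum: "\<mu> = (\<Sum>v\<in>Poly_Mapping.keys \<mu>. Poly_Mapping.single v (Poly_Mapping.lookup \<mu> v))"
  by (rule poly_sum)

lemma Var_power: "Var v ^ e = Poly_Mapping.single (Poly_Mapping.single v e) 1"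
  by (induction e) (simp_all add: Var_def mult_single single_add[symmetric])

lemma poly_induct [case_names Const Var add mult]:
  assumes C: "\<And>a. P (Const a)" and V: "\<And>v. P (Var v)"
    and A: "\<And>f g. P f \<Longrightarrow> P g \<Longrightarrow> P (f + g)"
    and M: "\<And>f g. P f \<Longrightarrow> P g \<Longrightarrow> P (f * g)"
  shows "P f"
proof -
  have P0: "P 0" using C[of 0] by (simp add: Const_def)
  have P1: "P 1" using C[of 1] by (simp add: Const_def)
  have sums: "(\<And>x. x \<in> X \<Longrightarrow> P (F x)) \<Longrightarrow> P (sum F X)" for F :: "(_ \<Rightarrow>\<^sub>0 nat) \<Rightarrow> _" and X
    by (induction X rule: infinite_finite_induct) (auto intro: P0 A)
  have mono: "P (Poly_Mapping.single (\<Sum>v\<in>X. Poly_Mapping.single v (e v)) 1)"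
    for X and e :: "_ \<Rightarrow> nat"
  proof (induction X rule: infinite_finite_induct)
    case (insert v X)
    have "P (Var v ^ k)" for k by (induction k) (auto intro: P1 M V)
    then have "P (Poly_Mapping.single (Poly_Mapping.single v (e v)) 1)" by (simp add: Var_power)
    from M[OF this insert.IH] show ?case using insert by (simp add: mult_single)
  qed (auto simp: P1)
  have "P (Poly_Mapping.single \<mu> a)" for \<mu> a
    using M[OF C mono[of "Poly_Mapping.lookup \<mu>" "Poly_Mapping.keys \<mu>"], of a]
    by (simp add: Const_def mult_single flip: mono_sum)
  then have "P (\<Sum>\<mu>\<in>Poly_Mapping.keys f. Poly_Mapping.single \<mu> (Poly_Mapping.lookup f \<mu>))"
    by (intro sums)
  then show ?thesis by (simp flip: poly_sum)
qed

lemma partial_deriv_single: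
  "partial_deriv v (Poly_Mapping.single \<mu> a) =
     Poly_Mapping.single (\<mu> - Poly_Mapping.single v 1) (of_nat (Poly_Mapping.lookup \<mu> v) * a)"
  by (subst partial_deriv_superset[where U="{\<mu>}"]) auto

lemma shift_aux:
  assumes "Poly_Mapping.lookup \<mu> v \<noteq> 0"
  shows "\<mu> + \<nu> - Poly_Mapping.single v (1::nat) = (\<mu> - Poly_Mapping.single v 1) + \<nu>"
  using assms by (intro poly_mapping_eqI) (auto simp: lookup_add lookup_minus lookup_single when_def)

lemma partial_deriv_mult_single:
  "partial_deriv v (Poly_Mapping.single \<mu> a * Poly_Mapping.single \<nu> b) =
   partial_deriv v (Poly_Mapping.single \<mu> a) * Poly_Mapping.single \<nu> b
   + Poly_Mapping.single \<mu> a * partial_deriv v (Poly_Mapping.single \<nu> b)"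
proof -
  have 1: "Poly_Mapping.single (\<mu> + \<nu> - Poly_Mapping.single v 1) (of_nat (Poly_Mapping.lookup \<mu> v) * a * b) =
        Poly_Mapping.single (\<mu> - Poly_Mapping.single v 1 + \<nu>) (of_nat (Poly_Mapping.lookup \<mu> v) * a * b)"
    by (cases "Poly_Mapping.lookup \<mu> v = 0") (simp, metis shift_aux)
  have 2: "Poly_Mapping.single (\<mu> + \<nu> - Poly_Mapping.single v 1) (of_nat (Poly_Mapping.lookup \<nu> v) * a * b) =
        Poly_Mapping.single (\<mu> + (\<nu> - Poly_Mapping.single v 1)) (of_nat (Poly_Mapping.lookup \<nu> v) * a * b)"
    by (cases "Poly_Mapping.lookup \<nu> v = 0") (simp, metis shift_aux add.commute)
  show ?thesis using 1 2
    by (simp add: mult_single partial_deriv_single lookup_add algebra_simps single_add)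
qed

lemma add_diff_diff: "(a + a') - (b + b') - (c + c') = a - b - c + (a' - b' - (c' :: 'a::ab_group_add))"
  by (simp add: algebra_simps)

lemma bilinear_ext:
  fixes B :: "('m,'n,'k::comm_ring_1) dpoly \<Rightarrow> ('m,'n,'k) dpoly \<Rightarrow> ('m,'n,'k) dpoly"
  assumes fg: "\<And>f f' g. B (f + f') g = B f g + B f' g" "\<And>f g g'. B f (g + g') = B f g + B f g'"
    and 0: "\<And>\<mu> a \<nu> b. B (Poly_Mapping.single \<mu> a) (Poly_Mapping.single \<nu> b) = 0"
  shows "B f g = 0"
proof -
  have z: "B 0 g = 0" "B f 0 = 0" for f g using fg(1)[of 0 0 g] fg(2)[of f 0 0] by auto
  have s1: "B (sum F X) g = (\<Sum>x\<in>X. B (F x) g)" for F :: "(_ \<Rightarrow>\<^sub>0 nat) \<Rightarrow> _" and X g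
    by (induction X rule: infinite_finite_induct) (auto simp: z fg)
  have s2: "B f (sum F X) = (\<Sum>x\<in>X. B f (F x))" for F :: "(_ \<Rightarrow>\<^sub>0 nat) \<Rightarrow> _" and X f
    by (induction X rule: infinite_finite_induct) (auto simp: z fg)
  show ?thesis
    by (subst poly_sum[of f], subst poly_sum[of g]) (simp only: s1 s2 0 sum.neutral_const)
qed

lemma partial_deriv_mult:
  fixes f g :: "('a, 'b, 'c::comm_ring_1) dpoly"
  shows "partial_deriv v (f * g) = partial_deriv v f * g + f * partial_deriv v g"
proof -
  have "partial_deriv v (f * g) - partial_deriv v f * g - f * partial_deriv v g = 0"
  proof (rule bilinear_ext[where B="\<lambda>f g. partial_deriv v (f * g) - partial_deriv v f * g - f * partial_deriv v g"])
    show "partial_deriv v ((f + f') * g) - partial_deriv v (f + f') * g - (f + f') * partial_deriv v g =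
      partial_deriv v (f * g) - partial_deriv v f * g - f * partial_deriv v g +
      (partial_deriv v (f' * g) - partial_deriv v f' * g - f' * partial_deriv v g)"
      for f f' g :: "('a, 'b, 'c) dpoly"
      unfolding distrib_right partial_deriv_add by (rule add_diff_diff)
    show "partial_deriv v (f * (g + g')) - partial_deriv v f * (g + g') - f * partial_deriv v (g + g') =
      partial_deriv v (f * g) - partial_deriv v f * g - f * partial_deriv v g +
      (partial_deriv v (f * g') - partial_deriv v f * g' - f * partial_deriv v g')"
      for f g g' :: "('a, 'b, 'c) dpoly"
      unfolding distrib_left partial_deriv_add by (rule add_diff_diff)
  qed (simp add: partial_deriv_mult_single)
  then show ?thesis by (simp add: algebra_simps)
qed

lemma map_coeffs_mult:
  fixes \<delta> :: "'k::comm_ring_1 \<Rightarrow> 'k"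
  assumes a: "\<And>a b. \<delta> (a + b) = \<delta> a + \<delta> b"
    and m: "\<And>a b. \<delta> (a * b) = \<delta> a * b + a * \<delta> b"
  shows "Poly_Mapping.map \<delta> (f * g) = Poly_Mapping.map \<delta> f * g + f * Poly_Mapping.map \<delta> (g::('m,'n,'k) dpoly)"
proof -
  have z: "\<delta> 0 = 0" using a by (rule additive_zero)
  have "Poly_Mapping.map \<delta> (f * g) - Poly_Mapping.map \<delta> f * g - f * Poly_Mapping.map \<delta> g = 0"
  proof (rule bilinear_ext[where B="\<lambda>f g. Poly_Mapping.map \<delta> (f * g) - Poly_Mapping.map \<delta> f * g - f * Poly_Mapping.map \<delta> g"])
    show "Poly_Mapping.map \<delta> ((f + f') * g) - Poly_Mapping.map \<delta> (f + f') * g - (f + f') * Poly_Mapping.map \<delta> g =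
      Poly_Mapping.map \<delta> (f * g) - Poly_Mapping.map \<delta> f * g - f * Poly_Mapping.map \<delta> g +
      (Poly_Mapping.map \<delta> (f' * g) - Poly_Mapping.map \<delta> f' * g - f' * Poly_Mapping.map \<delta> g)"
      for f f' g :: "('m,'n,'k) dpoly"
      unfolding distrib_right map_coeffs_add[of \<delta>, OF a] by (rule add_diff_diff)
    show "Poly_Mapping.map \<delta> (f * (g + g')) - Poly_Mapping.map \<delta> f * (g + g') - f * Poly_Mapping.map \<delta> (g + g') =
      Poly_Mapping.map \<delta> (f * g) - Poly_Mapping.map \<delta> f * g - f * Poly_Mapping.map \<delta> g +
      (Poly_Mapping.map \<delta> (f * g') - Poly_Mapping.map \<delta> f * g' - f * Poly_Mapping.map \<delta> g')"
      for f g g' :: "('m,'n,'k) dpoly"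
      unfolding distrib_left map_coeffs_add[of \<delta>, OF a] by (rule add_diff_diff)
  qed (simp add: mult_single m single_add z)
  then show ?thesis by (simp add: algebra_simps)
qed

lemma vars_mult: "vars (f * g) \<subseteq> vars f \<union> vars g"
proof
  fix v assume "v \<in> vars (f * g)"
  then obtain \<mu> where \<mu>: "\<mu> \<in> Poly_Mapping.keys (f * g)" and v: "v \<in> Poly_Mapping.keys \<mu>" by (auto simp: vars_def)
  then obtain \<alpha> \<beta> where "\<alpha> \<in> Poly_Mapping.keys f" "\<beta> \<in> Poly_Mapping.keys g" "\<mu> = \<alpha> + \<beta>"
    using keys_mult by blast
  then show "v \<in> vars f \<union> vars g" using v keys_add[of \<alpha> \<beta>] by (auto simp: vars_def)
qed

lemma deriv_poly_mult:
  assumes "differential_field d"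
  shows "deriv_poly d i (f * g) = deriv_poly d i f * g + f * deriv_poly d i g"
proof -
  let ?V = "vars f \<union> vars g"
  let ?x = "\<lambda>v. Var (theta_var (\<lambda>j. if j = i then 1 else 0) v)"
  have a: "d i (a + b) = d i a + d i b" "d i (a * b) = d i a * b + a * d i b" for a b
    using assms by (auto simp: differential_field_def)
  have "vars (f * g) \<subseteq> ?V" by (rule vars_mult)
  then have "deriv_poly d i (f * g) = Poly_Mapping.map (d i) f * g + f * Poly_Mapping.map (d i) g +
     (\<Sum>v\<in>?V. (partial_deriv v f * g + f * partial_deriv v g) * ?x v)"
    by (simp add: deriv_poly_superset[where V="?V"] partial_deriv_mult map_coeffs_mult[of "d i", OF a])
  also have "(\<Sum>v\<in>?V. (partial_deriv v f * g + f * partial_deriv v g) * ?x v) =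
    (\<Sum>v\<in>?V. partial_deriv v f * ?x v) * g + f * (\<Sum>v\<in>?V. partial_deriv v g * ?x v)"
    unfolding sum_distrib_left sum_distrib_right distrib_right sum.distrib
    by (intro arg_cong2[where f="(+)"] sum.cong refl) (simp_all add: mult.assoc mult.commute[of g])
  finally show ?thesis
    by (simp add: deriv_poly_superset[where V="?V" and f=f] deriv_poly_superset[where V="?V" and f=g] algebra_simps)
qed

lemma deriv_poly_Const:
  assumes "differential_field d"
  shows "deriv_poly d i (Const a) = Const (d i a)"
proof -
  have "d i 0 = 0" using assms by (intro additive_zero) (simp add: differential_field_def)
  then show ?thesis by (auto simp: deriv_poly_def Const_def vars_def)
qed

lemma deriv_poly_Var:
  assumes "differential_field d"
  shows "deriv_poly d i (Var v) = Var (theta_var (\<lambda>j. if j = i then 1 else 0) v)"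
proof -
  have z: "d i 0 = 0" using assms by (intro additive_zero) (simp add: differential_field_def)
  have "d i (1 * 1) = d i 1 * 1 + 1 * d i 1"
    using assms unfolding differential_field_def by blast
  then have "d i 1 + 0 = d i 1 + d i 1" unfolding mult_1 mult_1_right add_0_right .
  then have "d i 1 = 0" by (rule add_left_imp_eq[symmetric])
  with z show ?thesis
    by (simp add: deriv_poly_def vars_def Var_def partial_deriv_single mult_single)
qed

lemma deriv_poly_commute:
  assumes "differential_field d"
  shows "deriv_poly d i (deriv_poly d j f) = deriv_poly d j (deriv_poly d i f)"
proof (induction f rule: poly_induct)
  case (Const a)
  then show ?case using assms by (simp add: deriv_poly_Const) (simp add: differential_field_def)
next
  case (Var v)
  then show ?case using assms by (simp add: deriv_poly_Var theta_var_def) (simp add: add.left_commute)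
next
  case (add f g)
  then show ?case using assms by (simp add: deriv_poly_add)
next
  case (mult f g)
  then show ?case using assms by (simp add: deriv_poly_add deriv_poly_mult algebra_simps)
qed

lemma comp_fun_commute_deriv_poly:
  assumes "differential_field d"
  shows "comp_fun_commute (\<lambda>i. (deriv_poly d i :: ('m, 'n, 'k::field) dpoly \<Rightarrow> _) ^^ \<theta> i)"
proof
  fix i j
  have 1: "deriv_poly d i ((deriv_poly d j ^^ b) f) = (deriv_poly d j ^^ b) (deriv_poly d i f)" for b and f :: "('m, 'n, 'k) dpoly"
    by (induction b) (simp_all add: deriv_poly_commute[OF assms, of i j])
  have "(deriv_poly d i ^^ a) ((deriv_poly d j ^^ b) f) = (deriv_poly d j ^^ b) ((deriv_poly d i ^^ a) f)"
    for a b and f :: "('m, 'n, 'k) dpoly" by (induction a) (simp_all add: 1)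
  then show "(deriv_poly d j ^^ \<theta> j) \<circ> ((deriv_poly d i :: ('m, 'n, 'k) dpoly \<Rightarrow> _) ^^ \<theta> i) = (deriv_poly d i ^^ \<theta> i) \<circ> (deriv_poly d j ^^ \<theta> j)"
    by (intro ext) (metis comp_apply)
qed

lemma theta_poly_Var:
  assumes "differential_field d"
  shows "theta_poly d \<theta> (Var v) = Var (theta_var \<theta> v)"
proof -
  interpret comp_fun_commute "\<lambda>i. deriv_poly d i ^^ \<theta> i"
    using assms by (rule comp_fun_commute_deriv_poly)
  have 1: "(deriv_poly d i ^^ k) (Var u) = Var (theta_var (\<lambda>j. if j = i then k else 0) u)" for i k u
    by (induction k) (auto simp: deriv_poly_Var[OF assms] theta_var_def fun_eq_iff intro!: arg_cong[where f=Var])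
  have "finite X \<Longrightarrow> Finite_Set.fold (\<lambda>i. deriv_poly d i ^^ \<theta> i) (Var v) X =
     Var (theta_var (\<lambda>i. if i \<in> X then \<theta> i else 0) v)" for X
  proof (induction X rule: finite_induct)
    case (insert i X)
    then show ?case
      by (auto simp: 1 theta_var_def fun_eq_iff intro!: arg_cong[where f=Var])
  qed (simp add: theta_var_def)
  from this[of UNIV] show ?thesis by (simp add: theta_poly_def)
qed


section \<open>Orders, weights and rankings\<close>

definition ord_var :: "('m::finite, 'n) dvar \<Rightarrow> nat" where
  "ord_var v = (\<Sum>i\<in>UNIV. fst v i)"

definition weight_var :: "('m \<Rightarrow> nat) \<Rightarrow> ('m::finite, 'n) dvar \<Rightarrow> nat" where
  "weight_var c v = (\<Sum>i\<in>UNIV. c i * fst v i)"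

definition ord_poly :: "('m::finite, 'n, 'k::comm_ring_1) dpoly \<Rightarrow> nat" where
  "ord_poly f = Max (insert 0 (ord_var ` vars f))"

definition weight_poly :: "('m \<Rightarrow> nat) \<Rightarrow> ('m::finite, 'n, 'k::comm_ring_1) dpoly \<Rightarrow> nat" where
  "weight_poly c f = Max (insert 0 (weight_var c ` vars f))"

definition ord_wrt :: "'m \<Rightarrow> ('m, 'n, 'k::comm_ring_1) dpoly \<Rightarrow> nat" where
  "ord_wrt i f = Max (insert 0 ((\<lambda>v. fst v i) ` vars f))"

definition max_ord :: "('m::finite, 'n, 'k::comm_ring_1) dpoly set \<Rightarrow> nat" where
  "max_ord A = Max (insert 0 (ord_poly ` A))"

definition max_weight :: "('m \<Rightarrow> nat) \<Rightarrow> ('m::finite, 'n, 'k::comm_ring_1) dpoly set \<Rightarrow> nat" where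
  "max_weight c A = Max (insert 0 (weight_poly c ` A))"

text \<open>Rankings are given by their strict order relation.\<close>

definition ranking :: "(('m, 'n) dvar \<Rightarrow> ('m, 'n) dvar \<Rightarrow> bool) \<Rightarrow> bool" where
  "ranking lt \<longleftrightarrow>
     irreflp lt \<and> transp lt \<and> totalp lt \<and>
     (\<forall>\<theta> u. \<theta> \<noteq> (\<lambda>_. 0) \<longrightarrow> lt u (theta_var \<theta> u)) \<and>
     (\<forall>\<theta> u v. \<theta> \<noteq> (\<lambda>_. 0) \<longrightarrow> lt u v \<longrightarrow> lt (theta_var \<theta> u) (theta_var \<theta> v))"

definition weighted_ranking ::
    "('m::finite \<Rightarrow> nat) \<Rightarrow> (('m, 'n) dvar \<Rightarrow> ('m, 'n) dvar \<Rightarrow> bool) \<Rightarrow> bool" where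
  "weighted_ranking c lt \<longleftrightarrow>
     ranking lt \<and> (\<forall>u v. weight_var c u < weight_var c v \<longrightarrow> lt u v)"

context
  fixes lt :: "('m, 'n) dvar \<Rightarrow> ('m, 'n) dvar \<Rightarrow> bool"
begin

text \<open>Leaders, initials, separants and ranks are meaningful only for \<open>f \<notin> ground\<close>.\<close>

definition lead :: "('m, 'n, 'k::comm_ring_1) dpoly \<Rightarrow> ('m, 'n) dvar" where
  "lead f = (THE v. v \<in> vars f \<and> (\<forall>u\<in>vars f. u \<noteq> v \<longrightarrow> lt u v))"

definition lead_deg :: "('m, 'n, 'k::comm_ring_1) dpoly \<Rightarrow> nat" where
  "lead_deg f = deg_in (lead f) f"

definition init :: "('m, 'n, 'k::comm_ring_1) dpoly \<Rightarrow> ('m, 'n, 'k) dpoly" where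
  "init f = coeff_in (lead f) (lead_deg f) f"

definition sep :: "('m, 'n, 'k::comm_ring_1) dpoly \<Rightarrow> ('m, 'n, 'k) dpoly" where
  "sep f = partial_deriv (lead f) f"

definition rank :: "('m, 'n, 'k::comm_ring_1) dpoly \<Rightarrow> ('m, 'n, 'k) dpoly" where
  "rank f = Var (lead f) ^ lead_deg f"

text \<open>Comparison of ranks; elements of the ground field count as lowest.\<close>

definition rank_le :: "('m, 'n, 'k::comm_ring_1) dpoly \<Rightarrow> ('m, 'n, 'k) dpoly \<Rightarrow> bool" where
  "rank_le f g \<longleftrightarrow>
     f \<in> ground \<or>
     g \<notin> ground \<and> (lt (lead f) (lead g) \<or> lead f = lead g \<and> lead_deg f \<le> lead_deg g)"

definition leaders :: "('m, 'n, 'k::comm_ring_1) dpoly set \<Rightarrow> ('m, 'n) dvar set" where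
  "leaders A = lead ` A"

definition seps :: "('m, 'n, 'k::comm_ring_1) dpoly set \<Rightarrow> ('m, 'n, 'k) dpoly set" where
  "seps A = sep ` A"

definition inits_seps :: "('m, 'n, 'k::comm_ring_1) dpoly set \<Rightarrow> ('m, 'n, 'k) dpoly set" where
  "inits_seps A = init ` A \<union> sep ` A"

definition partially_reduced :: "('m, 'n, 'k::comm_ring_1) dpoly \<Rightarrow> ('m, 'n, 'k) dpoly \<Rightarrow> bool" where
  "partially_reduced f g \<longleftrightarrow> (\<forall>\<theta>. \<theta> \<noteq> (\<lambda>_. 0) \<longrightarrow> theta_var \<theta> (lead g) \<notin> vars f)"

definition reduced :: "('m, 'n, 'k::comm_ring_1) dpoly \<Rightarrow> ('m, 'n, 'k) dpoly \<Rightarrow> bool" where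
  "reduced f g \<longleftrightarrow> partially_reduced f g \<and> deg_in (lead g) f < deg_in (lead g) g"

definition autoreduced :: "('m, 'n, 'k::comm_ring_1) dpoly set \<Rightarrow> bool" where
  "autoreduced A \<longleftrightarrow>
     A \<inter> ground = {} \<and> (\<forall>f\<in>A. \<forall>g\<in>A. f \<noteq> g \<longrightarrow> reduced f g)"

text \<open>
  The leaders are counted as a family: distinct elements are required to have distinct
  leaders.
\<close>

definition weak_d_triangular :: "('m, 'n, 'k::comm_ring_1) dpoly set \<Rightarrow> bool" where
  "weak_d_triangular A \<longleftrightarrow>
     A \<inter> ground = {} \<and> inj_on lead A \<and>
     autoreduced ((Var :: _ \<Rightarrow> ('m, 'n, 'k) dpoly) ` leaders A)"

end


section \<open>Reduction and the Rosenfeld-Groebner algorithm\<close>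

text \<open>
  The two reduction procedures enter only through what is required of their results.
\<close>

definition pd_reduction ::
    "('m \<Rightarrow> 'k::comm_ring_1 \<Rightarrow> 'k) \<Rightarrow> (('m, 'n) dvar \<Rightarrow> ('m, 'n) dvar \<Rightarrow> bool) \<Rightarrow>
     (('m, 'n, 'k) dpoly \<Rightarrow> ('m, 'n, 'k) dpoly set \<Rightarrow> ('m, 'n, 'k) dpoly) \<Rightarrow> bool" where
  "pd_reduction d lt pd_red \<longleftrightarrow>
     (\<forall>f A. weak_d_triangular lt A \<longrightarrow>
        (\<forall>a\<in>A. partially_reduced lt (pd_red f A) a) \<and>
        (\<exists>s\<in>mult_closure (seps lt A). s * f - pd_red f A \<in> diff_ideal d A) \<and>
        rank_le lt (pd_red f A) f)"

definition d_reduction ::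
    "('m \<Rightarrow> 'k::comm_ring_1 \<Rightarrow> 'k) \<Rightarrow> (('m, 'n) dvar \<Rightarrow> ('m, 'n) dvar \<Rightarrow> bool) \<Rightarrow>
     (('m, 'n, 'k) dpoly \<Rightarrow> ('m, 'n, 'k) dpoly set \<Rightarrow> ('m, 'n, 'k) dpoly) \<Rightarrow> bool" where
  "d_reduction d lt d_red \<longleftrightarrow>
     (\<forall>f A. weak_d_triangular lt A \<longrightarrow>
        (\<forall>a\<in>A. reduced lt (d_red f A) a) \<and>
        (\<exists>h\<in>mult_closure (inits_seps lt A). h * f - d_red f A \<in> diff_ideal d A) \<and>
        rank_le lt (d_red f A) f)"

definition lcd_exp :: "('m, 'n) dvar \<Rightarrow> ('m, 'n) dvar \<Rightarrow> 'm theta" where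
  "lcd_exp u v = (\<lambda>i. max (fst u i) (fst v i))"

definition delta_poly ::
    "('m::finite \<Rightarrow> 'k::comm_ring_1 \<Rightarrow> 'k) \<Rightarrow> (('m, 'n) dvar \<Rightarrow> ('m, 'n) dvar \<Rightarrow> bool) \<Rightarrow>
     ('m, 'n, 'k) dpoly \<Rightarrow> ('m, 'n, 'k) dpoly \<Rightarrow> ('m, 'n, 'k) dpoly" where
  "delta_poly d lt f g =
     (let u = lead lt f; v = lead lt g in
      if snd u \<noteq> snd v then 0
      else sep lt g * theta_poly d (\<lambda>i. lcd_exp u v i - fst u i) f
         - sep lt f * theta_poly d (\<lambda>i. lcd_exp u v i - fst v i) g)"

type_synonym ('m, 'n, 'k) rg_tuple =
  "('m, 'n, 'k) dpoly set \<times> ('m, 'n, 'k) dpoly set \<times> ('m, 'n, 'k) dpoly set \<times> ('m, 'n, 'k) dpoly set"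

definition rg_update ::
    "('m::finite \<Rightarrow> 'k::comm_ring_1 \<Rightarrow> 'k) \<Rightarrow> (('m, 'n) dvar \<Rightarrow> ('m, 'n) dvar \<Rightarrow> bool) \<Rightarrow>
     ('m, 'n, 'k) dpoly set \<Rightarrow> ('m, 'n, 'k) dpoly set \<Rightarrow> ('m, 'n, 'k) dpoly set \<Rightarrow>
     ('m, 'n, 'k) dpoly set \<Rightarrow> ('m, 'n, 'k) dpoly \<Rightarrow> ('m, 'n, 'k) rg_tuple" where
  "rg_update d lt G D A H p =
     (let G\<^sub>A = {a \<in> A. \<exists>\<theta>. lead lt a = theta_var \<theta> (lead lt p)}; A' = A - G\<^sub>A
      in (G \<union> G\<^sub>A, (D \<union> delta_poly d lt p ` A') - {0}, A' \<union> {p}, H \<union> {sep lt p, init lt p}))"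

text \<open>The first argument lists the elements still to be processed, by increasing leader.\<close>

fun apr_loop ::
    "(('m, 'n) dvar \<Rightarrow> ('m, 'n) dvar \<Rightarrow> bool) \<Rightarrow>
     (('m, 'n, 'k::comm_ring_1) dpoly \<Rightarrow> ('m, 'n, 'k) dpoly set \<Rightarrow> ('m, 'n, 'k) dpoly) \<Rightarrow>
     ('m, 'n, 'k) dpoly list \<Rightarrow> ('m, 'n, 'k) dpoly set \<Rightarrow> ('m, 'n, 'k) dpoly set option" where
  "apr_loop lt pd_red [] B = Some B"
| "apr_loop lt pd_red (a # as) B =
     (let b = pd_red a B in
      if b \<notin> ground \<and> rank lt b = rank lt a then apr_loop lt pd_red as (B \<union> {b}) else None)"

definition by_leader ::
    "(('m, 'n) dvar \<Rightarrow> ('m, 'n) dvar \<Rightarrow> bool) \<Rightarrow>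
     ('m, 'n, 'k::comm_ring_1) dpoly set \<Rightarrow> ('m, 'n, 'k) dpoly list" where
  "by_leader lt A = (THE as. set as = A \<and> sorted_wrt (\<lambda>a b. lt (lead lt a) (lead lt b)) as)"

definition auto_partial_reduce ::
    "(('m, 'n) dvar \<Rightarrow> ('m, 'n) dvar \<Rightarrow> bool) \<Rightarrow>
     (('m, 'n, 'k::comm_ring_1) dpoly \<Rightarrow> ('m, 'n, 'k) dpoly set \<Rightarrow> ('m, 'n, 'k) dpoly) \<Rightarrow>
     ('m, 'n, 'k) dpoly set \<Rightarrow> ('m, 'n, 'k) dpoly set \<Rightarrow>
     (('m, 'n, 'k) dpoly set \<times> ('m, 'n, 'k) dpoly set) set" where
  "auto_partial_reduce lt pd_red A H =
     (case apr_loop lt pd_red (by_leader lt A) {} of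
        None \<Rightarrow> {}
      | Some B \<Rightarrow>
          (let K = inits_seps lt B \<union> {pd_red q B | q. q \<in> H - inits_seps lt A}
           in if 0 \<in> K then {} else {(B, K)}))"

text \<open>
  One pass through the main loop; a state consists of the tuples still to be treated and
  of the output so far. The choice of the tuple and of \<open>p\<close> is nondeterministic.
\<close>

inductive rg_step ::
    "('m::finite \<Rightarrow> 'k::comm_ring_1 \<Rightarrow> 'k) \<Rightarrow> (('m, 'n) dvar \<Rightarrow> ('m, 'n) dvar \<Rightarrow> bool) \<Rightarrow>
     (('m, 'n, 'k) dpoly \<Rightarrow> ('m, 'n, 'k) dpoly set \<Rightarrow> ('m, 'n, 'k) dpoly) \<Rightarrow>
     (('m, 'n, 'k) dpoly \<Rightarrow> ('m, 'n, 'k) dpoly set \<Rightarrow> ('m, 'n, 'k) dpoly) \<Rightarrow>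
     ('m, 'n, 'k) rg_tuple set \<times> (('m, 'n, 'k) dpoly set \<times> ('m, 'n, 'k) dpoly set) set \<Rightarrow>
     ('m, 'n, 'k) rg_tuple set \<times> (('m, 'n, 'k) dpoly set \<times> ('m, 'n, 'k) dpoly set) set \<Rightarrow> bool"
  for d lt pd_red d_red where
  finish:
    "(G, D, A, H) \<in> S \<Longrightarrow> G \<union> D = {} \<Longrightarrow>
     rg_step d lt pd_red d_red (S, \<A>)
       (S - {(G, D, A, H)}, \<A> \<union> auto_partial_reduce lt pd_red A H)"
| zero:
    "(G, D, A, H) \<in> S \<Longrightarrow> p \<in> G \<union> D \<Longrightarrow> d_red p A = 0 \<Longrightarrow>
     rg_step d lt pd_red d_red (S, \<A>)
       ((S - {(G, D, A, H)}) \<union> {(G - {p}, D - {p}, A, H)}, \<A>)"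
| nonzero_ground:
    "(G, D, A, H) \<in> S \<Longrightarrow> p \<in> G \<union> D \<Longrightarrow> d_red p A \<in> ground - {0} \<Longrightarrow>
     rg_step d lt pd_red d_red (S, \<A>) (S - {(G, D, A, H)}, \<A>)"
| split:
    "(G, D, A, H) \<in> S \<Longrightarrow> p \<in> G \<union> D \<Longrightarrow> q = d_red p A \<Longrightarrow> q \<notin> ground \<Longrightarrow>
     q\<^sub>i = q - init lt q * rank lt q \<Longrightarrow>
     q\<^sub>s = of_nat (lead_deg lt q) * q - Var (lead lt q) * sep lt q \<Longrightarrow>
     rg_step d lt pd_red d_red (S, \<A>)
       ((S - {(G, D, A, H)}) \<union>
          {rg_update d lt (G - {p}) (D - {p}) A H q,
           ((G - {p}) \<union> {q\<^sub>s, sep lt q}, D - {p}, A, H \<union> {init lt q}),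
           ((G - {p}) \<union> {q\<^sub>i, init lt q}, D - {p}, A, H)}, \<A>)"

text \<open>\<open>\<A>\<close> is returned by some run of the algorithm on the input \<open>(F, K)\<close>.\<close>

definition Rosenfeld_Groebner ::
    "('m::finite \<Rightarrow> 'k::comm_ring_1 \<Rightarrow> 'k) \<Rightarrow> (('m, 'n) dvar \<Rightarrow> ('m, 'n) dvar \<Rightarrow> bool) \<Rightarrow>
     (('m, 'n, 'k) dpoly \<Rightarrow> ('m, 'n, 'k) dpoly set \<Rightarrow> ('m, 'n, 'k) dpoly) \<Rightarrow>
     (('m, 'n, 'k) dpoly \<Rightarrow> ('m, 'n, 'k) dpoly set \<Rightarrow> ('m, 'n, 'k) dpoly) \<Rightarrow>
     ('m, 'n, 'k) dpoly set \<Rightarrow> ('m, 'n, 'k) dpoly set \<Rightarrow>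
     (('m, 'n, 'k) dpoly set \<times> ('m, 'n, 'k) dpoly set) set \<Rightarrow> bool" where
  "Rosenfeld_Groebner d lt pd_red d_red F K \<A> \<longleftrightarrow>
     (rg_step d lt pd_red d_red)\<^sup>*\<^sup>* ({(F, {}, {}, K)}, {}) ({}, \<A>)"


section \<open>Antichain sequences and the bounding sequence\<close>

definition below :: "('m, 'n) dvar \<Rightarrow> ('m, 'n) dvar \<Rightarrow> bool" where
  "below s t \<longleftrightarrow> snd s = snd t \<and> (\<forall>r. fst s r \<le> fst t r)"

definition antichain_seq :: "('m, 'n) dvar list \<Rightarrow> bool" where
  "antichain_seq ss \<longleftrightarrow>
     (\<forall>i<length ss. \<forall>j<length ss. i \<noteq> j \<longrightarrow> \<not> below (ss ! i) (ss ! j))"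

text \<open>The terms of a sequence are numbered from 1.\<close>

definition bounds_degree_growth :: "(nat \<Rightarrow> int) \<Rightarrow> ('m::finite, 'n) dvar list \<Rightarrow> bool" where
  "bounds_degree_growth f ss \<longleftrightarrow> (\<forall>i<length ss. int (ord_var (ss ! i)) \<le> f (i + 1))"

definition max_antichain_length ::
    "'m::finite itself \<Rightarrow> 'n::finite itself \<Rightarrow> (nat \<Rightarrow> int) \<Rightarrow> nat" where
  "max_antichain_length _ _ f =
     Max {length ss | ss :: ('m, 'n) dvar list. antichain_seq ss \<and> bounds_degree_growth f ss}"

text \<open>For \<open>h = 0\<close> the values become negative from \<open>k = n + 2\<close> on, hence the type.\<close>

fun fib_bound :: "nat \<Rightarrow> nat \<Rightarrow> nat \<Rightarrow> int" where
  "fib_bound n h 0 = 0"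
| "fib_bound n h (Suc 0) = int h"
| "fib_bound n h (Suc (Suc 0)) = int h"
| "fib_bound n h (Suc (Suc (Suc k))) =
     fib_bound n h (Suc (Suc k)) + fib_bound n h (Suc k) -
     (if Suc (Suc (Suc k)) \<le> n + 1 then 0 else 1)"

end

theory Submission
  imports Defs
begin

text \<open>
  Along a branch of the algorithm only the \<open>\<Delta>\<close>-polynomials can raise the weight, and
  \<open>\<Delta>(f, g)\<close> has at most the weight of the least common derivative of the leaders \<open>u\<close>, \<open>v\<close>, that
  is, at most \<open>w(u) + w(v)\<close>. So if \<open>b\<^sub>1, b\<^sub>2, \<dots>\<close> satisfies the Fibonacci recurrence and
  the weight \<open>b\<^sub>k\<^sub>+\<^sub>1\<close> is exceeded, then one of \<open>u\<close>, \<open>v\<close> has weight above \<open>b\<^sub>k\<close>, or both have weight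
  above \<open>b\<^sub>k\<^sub>-\<^sub>1\<close>. A new leader is reduced, so it is not above an earlier one, and if it is
  heavier it is not below an earlier one either. Hence it, or the pair, extends an antichain sequence
  that existed when the weight first exceeded \<open>b\<^sub>k\<close> (or \<open>b\<^sub>k\<^sub>-\<^sub>1\<close>) to length \<open>k + 1\<close>. This bounds
  the number of times that the weight can increase by the maximal length of an antichain sequence.

  With two derivations, \<open>w(lcd(u, v)) < w(u) + w(v)\<close> unless \<open>u\<close>, \<open>v\<close> are pure powers of different
  derivations. Every indeterminate can cause such an exceptional step only once, and the last
  one cannot cause any, because then all reduced derivatives lie in boxes below pure powers.
  The worst case is that the \<open>n - 1\<close> exceptional steps come first.
\<close>

section \<open>Divisibility of derivatives, weights, and antichain sequences\<close>

lemma below_refl: "below u u"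
  by (simp add: below_def)

lemma below_trans: "below u v \<Longrightarrow> below v t \<Longrightarrow> below u t"
  by (auto simp: below_def intro: order_trans)

lemma below_antisym: "below u v \<Longrightarrow> below v u \<Longrightarrow> u = v"
  by (auto simp: below_def prod_eq_iff fun_eq_iff intro: antisym)

lemma below_iff_theta_var: "below u v \<longleftrightarrow> (\<exists>\<theta>. v = theta_var \<theta> u)"
proof
  assume "below u v"
  then have "v = theta_var (\<lambda>i. fst v i - fst u i) u"
    by (auto simp: below_def theta_var_def prod_eq_iff)
  then show "\<exists>\<theta>. v = theta_var \<theta> u" by blast
qed (auto simp: below_def theta_var_def)

lemma theta_var_0 [simp]: "theta_var (\<lambda>_. 0) u = u"
  by (simp add: theta_var_def)

lemma weight_var_mono: "below u v \<Longrightarrow> weight_var c u \<le> weight_var c v"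
  unfolding weight_var_def below_def by (intro sum_mono mult_left_mono) auto

text \<open>All \<open>c i\<close> are at least 1, so a sequence with bounded weights also has
  bounded degrees. This is how chains of leaders come to be measured by
  \<open>max_antichain_length\<close>.\<close>

lemma ord_var_le_weight_var:
  assumes "\<forall>i. 0 < c i"
  shows "ord_var v \<le> weight_var c v"
  unfolding ord_var_def weight_var_def
  using assms by (intro sum_mono) (simp add: Suc_le_eq)

lemma weight_lcd_le:
  "weight_var c (lcd_exp u v, y) \<le> weight_var c u + weight_var c v"
  unfolding weight_var_def lcd_exp_def sum.distrib[symmetric]
  by (intro sum_mono) (auto simp: max_def algebra_simps)

lemma antichain_seq_Nil [simp]: "antichain_seq []"
  by (simp add: antichain_seq_def)

lemma antichain_seq_snoc:
  assumes "antichain_seq ss" and "\<And>s. s \<in> set ss \<Longrightarrow> \<not> below s x \<and> \<not> below x s"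
  shows "antichain_seq (ss @ [x])"
  using assms unfolding antichain_seq_def
  by (auto simp: nth_append less_Suc_eq)

lemma antichain_seq_prefix:
  assumes "antichain_seq (ss @ ts)"
  shows "antichain_seq ss"
  unfolding antichain_seq_def
proof (intro allI impI)
  fix i j
  assume "i < length ss" "j < length ss" "i \<noteq> j"
  then show "\<not> below (ss ! i) (ss ! j)"
    using assms[unfolded antichain_seq_def, rule_format, of i j] by (simp add: nth_append)
qed


section \<open>Antichain sequences of bounded degree growth have bounded length\<close>

lemma monotone_subsequence_functions:
  fixes s :: "nat \<Rightarrow> 'm \<Rightarrow> nat"
  assumes "finite X"
  shows "\<exists>r :: nat \<Rightarrow> nat. strict_mono r \<and> (\<forall>i\<in>X. \<forall>a b. a \<le> b \<longrightarrow> s (r a) i \<le> s (r b) i)"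
  using assms
proof (induction X)
  case empty
  have "strict_mono (id :: nat \<Rightarrow> nat)" by (simp add: strict_mono_def)
  then show ?case by blast
next
  case (insert x X)
  then obtain r :: "nat \<Rightarrow> nat"
    where r: "strict_mono r" "\<forall>i\<in>X. \<forall>a b. a \<le> b \<longrightarrow> s (r a) i \<le> s (r b) i"
    by blast
  obtain t :: "nat \<Rightarrow> nat" where t: "strict_mono t" "mono (\<lambda>n. s (r (t n)) x)"
  proof -
    let ?g = "\<lambda>n. s (r n) x"
    have "\<exists>t :: nat \<Rightarrow> nat. strict_mono t \<and> mono (\<lambda>n. ?g (t n))"
    proof -
      \<comment> \<open>\<open>min_after k\<close> is a position of the minimum of \<open>?g\<close>
        over all indices beyond \<open>k\<close>. Every \<open>t n\<close> is such a position for
        some \<open>k < t n\<close>, so no later value is smaller.\<close>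
      define min_after where "min_after = (\<lambda>k. ARG_MIN ?g n. n > k)"
      have ma: "min_after k > k \<and> (\<forall>n>k. ?g (min_after k) \<le> ?g n)" for k
        using arg_min_nat_lemma[of "\<lambda>n. n > k" "Suc k" ?g] by (auto simp: min_after_def)
      define t where "t = rec_nat (min_after 0) (\<lambda>_ k. min_after k)"
      have ts: "t (Suc n) = min_after (t n)" for n by (simp add: t_def)
      have sm: "strict_mono t" by (rule strict_mono_Suc_iff[THEN iffD2]) (simp add: ts ma)
      have t_form: "\<exists>k. t n = min_after k \<and> k < t n" for n
        using ma by (cases n) (auto simp: t_def)
      have "?g (t n) \<le> ?g (t (Suc n))" for n
      proof -
        obtain k where k: "t n = min_after k" "k < t n" using t_form by blast
        have "t n < t (Suc n)" using sm by (simp add: strict_mono_Suc_iff)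
        then show ?thesis using k ma[of k] by simp
      qed
      then have "mono (\<lambda>n. ?g (t n))" by (simp add: mono_iff_le_Suc)
      with sm show ?thesis by blast
    qed
    then show ?thesis using that by blast
  qed
  have "strict_mono (r \<circ> t)" using r(1) t(1) by (rule strict_mono_o)
  moreover have "\<forall>i\<in>insert x X. \<forall>a b. a \<le> b \<longrightarrow> s ((r \<circ> t) a) i \<le> s ((r \<circ> t) b) i"
    using r(2) t by (auto simp: mono_def strict_mono_less_eq)
  ultimately show ?case by blast
qed

text \<open>A subsequence that is monotone in all exponents at once still has infinitely many terms,
  and two of them share their indeterminate because \<open>'n\<close> is finite.\<close>

lemma dickson:
  fixes s :: "nat \<Rightarrow> ('m::finite, 'n::finite) dvar"
  shows "\<exists>i j. i < j \<and> below (s i) (s j)"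
proof -
  obtain r :: "nat \<Rightarrow> nat" where r: "strict_mono r"
      "\<forall>i. \<forall>a b. a \<le> b \<longrightarrow> fst (s (r a)) i \<le> fst (s (r b)) i"
    using monotone_subsequence_functions[of UNIV "\<lambda>n. fst (s n)"] by auto
  have "\<not> inj (\<lambda>n. snd (s (r n)))"
    using finite_imageD[of "\<lambda>n. snd (s (r n))" UNIV] by auto
  then obtain a b where ab: "a < b" "snd (s (r a)) = snd (s (r b))"
    unfolding inj_def by (metis linorder_neqE_nat)
  then have "r a < r b" "below (s (r a)) (s (r b))"
    using r by (auto simp: strict_mono_less below_def)
  then show ?thesis by blast
qed

lemma finite_ord_var_le: "finite {v :: ('m::finite, 'n::finite) dvar. int (ord_var v) \<le> N}"
proof -
  let ?Fun = "{g :: 'm \<Rightarrow> nat. \<forall>i. (i \<in> UNIV \<longrightarrow> g i \<in> {..nat N}) \<and> (i \<notin> UNIV \<longrightarrow> g i = 0)}"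
  have "fst v \<in> ?Fun" if "int (ord_var v) \<le> N" for v :: "('m, 'n) dvar"
  proof -
    have "ord_var v \<le> nat N" using that by simp
    moreover have "fst v i \<le> ord_var v" for i
      unfolding ord_var_def by (rule member_le_sum) auto
    ultimately have "fst v i \<le> nat N" for i
      by (blast intro: order_trans)
    then show ?thesis by blast
  qed
  then have "{v :: ('m, 'n) dvar. int (ord_var v) \<le> N} \<subseteq> ?Fun \<times> UNIV"
    by (intro subsetI) (simp only: mem_Times_iff mem_Collect_eq[of _ "\<lambda>v. int (ord_var v) \<le> N"] UNIV_I simp_thms)
  moreover have "finite ?Fun"
    by (rule finite_set_of_finite_funs) auto
  then have "finite (?Fun \<times> (UNIV :: 'n set))"
    by (rule finite_cartesian_product) simp
  ultimately show ?thesis by (rule finite_subset)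
qed

definition bounded_antichain :: "(nat \<Rightarrow> int) \<Rightarrow> ('m::finite, 'n) dvar list \<Rightarrow> bool" where
  "bounded_antichain f ss \<longleftrightarrow> antichain_seq ss \<and> bounds_degree_growth f ss"

lemma bounded_antichain_prefix:
  assumes "bounded_antichain f (ss @ ts)"
  shows "bounded_antichain f ss"
  unfolding bounded_antichain_def bounds_degree_growth_def
proof (intro conjI allI impI)
  show "antichain_seq ss"
    using assms by (auto simp: bounded_antichain_def intro: antichain_seq_prefix)
  fix i
  assume "i < length ss"
  then show "int (ord_var (ss ! i)) \<le> f (i + 1)"
    using assms[unfolded bounded_antichain_def bounds_degree_growth_def, THEN conjunct2, rule_format, of i]
    by (simp add: nth_append)
qed

text \<open>A Koenig argument on the tree of these sequences: the degree bound leaves finitely many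
  one-term extensions of each, and \<open>dickson\<close> excludes infinite branches.\<close>

lemma finite_bounded_antichain_lengths:
  "finite {length ss | ss :: ('m::finite, 'n::finite) dvar list.
     antichain_seq ss \<and> bounds_degree_growth f ss}"
proof -
  \<comment> \<open>Longer sequences count as smaller, so the induction hypothesis speaks of the
    extensions of \<open>ss\<close>.\<close>
  define R :: "(('m, 'n) dvar list \<times> ('m, 'n) dvar list) set"
    where "R = {(ss @ [x], ss) | ss x. bounded_antichain f (ss @ [x])}"
  have "wf R"
    unfolding wf_iff_no_infinite_down_chain
  proof
    assume "\<exists>q. \<forall>i. (q (Suc i), q i) \<in> R"
    then obtain q where q: "\<And>i. (q (Suc i), q i) \<in> R" by blast
    define s where "s i = last (q (Suc i))" for i
    have s: "q (Suc i) = q i @ [s i]" and bq: "bounded_antichain f (q (Suc i))" for i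
      using q[of i] by (auto simp: R_def s_def)
    have len: "length (q i) = length (q 0) + i" for i
      by (induction i) (auto simp: s)
    have nth: "i < j \<Longrightarrow> q j ! (length (q 0) + i) = s i" for i j
    proof (induction j)
      case (Suc j)
      then show ?case using len[of i] len[of j]
        by (cases "i = j") (auto simp: s nth_append)
    qed simp
    obtain i j where ij: "i < j" "below (s i) (s j)" using dickson by blast
    have "\<not> below (q (Suc j) ! (length (q 0) + i)) (q (Suc j) ! (length (q 0) + j))"
      using bq[of j] ij(1) len[of "Suc j"]
      unfolding bounded_antichain_def antichain_seq_def by auto
    then show False using ij nth[of i "Suc j"] nth[of j "Suc j"] by simp
  qed
  then have "finite {length (ss @ ts) | ts. bounded_antichain f (ss @ ts)}" for ss :: "('m, 'n) dvar list"
  proof (induction ss rule: wf_induct_rule)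
    case (less ss)
    define X where "X = {x. bounded_antichain f (ss @ [x])}"
    have "X \<subseteq> {v. int (ord_var v) \<le> f (length ss + 1)}"
      unfolding X_def bounded_antichain_def bounds_degree_growth_def by auto
    then have "finite X" using finite_ord_var_le by (rule finite_subset)
    moreover have "finite {length ((ss @ [x]) @ ts) | ts. bounded_antichain f ((ss @ [x]) @ ts)}"
      if "x \<in> X" for x
      using that unfolding X_def by (intro less, unfold R_def) blast
    ultimately have "finite (insert (length ss)
        (\<Union>x\<in>X. {length ((ss @ [x]) @ ts) | ts. bounded_antichain f ((ss @ [x]) @ ts)}))"
      by blast
    moreover have "{length (ss @ ts) | ts. bounded_antichain f (ss @ ts)} \<subseteq> insert (length ss)
        (\<Union>x\<in>X. {length ((ss @ [x]) @ ts) | ts. bounded_antichain f ((ss @ [x]) @ ts)})"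
    proof clarify
      fix ts
      assume ts: "bounded_antichain f (ss @ ts)" and
        no: "length (ss @ ts) \<notin>
          (\<Union>x\<in>X. {length ((ss @ [x]) @ ts) | ts. bounded_antichain f ((ss @ [x]) @ ts)})"
      show "length (ss @ ts) = length ss"
      proof (cases ts)
        case (Cons x us)
        then have "bounded_antichain f ((ss @ [x]) @ us)" using ts by simp
        moreover from this have "x \<in> X" unfolding X_def using bounded_antichain_prefix by blast
        ultimately have "length ((ss @ [x]) @ us) \<in>
          (\<Union>x\<in>X. {length ((ss @ [x]) @ ts) | ts. bounded_antichain f ((ss @ [x]) @ ts)})"
          by blast
        then show ?thesis using no Cons by simp
      qed simp
    qed
    ultimately show ?case by (rule rev_finite_subset)
  qed
  from this[of "[]"] show ?thesis by (simp add: bounded_antichain_def)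
qed

lemma length_le_max_antichain_length:
  fixes ss :: "('m::finite, 'n::finite) dvar list"
  assumes "antichain_seq ss" and "bounds_degree_growth f ss"
  shows "length ss \<le> max_antichain_length TYPE('m) TYPE('n) f"
  unfolding max_antichain_length_def
  using assms by (intro Max_ge finite_bounded_antichain_lengths) blast

text \<open>This serves the case \<open>h = 0\<close> with two derivations, where the maximal length
  itself must be bounded from above because \<open>fib_bound\<close> eventually turns
  negative.\<close>

lemma max_antichain_length_attained:
  "\<exists>ss :: ('m::finite, 'n::finite) dvar list. antichain_seq ss \<and> bounds_degree_growth f ss \<and>
     length ss = max_antichain_length TYPE('m) TYPE('n) f"
proof -
  let ?N = "{length ss | ss :: ('m, 'n) dvar list. antichain_seq ss \<and> bounds_degree_growth f ss}"
  have "bounds_degree_growth f ([] :: ('m, 'n) dvar list)" by (simp add: bounds_degree_growth_def)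
  then have "?N \<noteq> {}" using antichain_seq_Nil by blast
  from Max_in[OF finite_bounded_antichain_lengths this] show ?thesis
    unfolding max_antichain_length_def by fastforce
qed

section \<open>Fibonacci-like bounds\<close>

text \<open>
  \<open>E\<close> is the set of exceptional indices, at which nothing is subtracted: \<open>E = UNIV\<close>
  gives \<open>h * fib k\<close>, and \<open>E = {..n + 1}\<close> gives \<open>fib_bound\<close>.
\<close>

fun bnd :: "nat \<Rightarrow> nat set \<Rightarrow> nat \<Rightarrow> int" where
  "bnd h E 0 = 0"
| "bnd h E (Suc 0) = int h"
| "bnd h E (Suc (Suc 0)) = int h"
| "bnd h E (Suc (Suc (Suc k))) =
     bnd h E (Suc (Suc k)) + bnd h E (Suc k) - (if Suc (Suc (Suc k)) \<in> E then 0 else 1)"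

lemma fib_bound_eq_bnd: "fib_bound n h k = bnd h {..n + 1} k"
  by (induction n h k rule: fib_bound.induct) auto

lemma fib_eq_bnd: "int (h * fib k) = bnd h UNIV k"
  by (induction h "UNIV :: nat set" k rule: bnd.induct) (auto simp: algebra_simps)

lemma bnd_rec:
  "k \<ge> 2 \<Longrightarrow> bnd h E (k + 1) = bnd h E k + bnd h E (k - 1) - (if k + 1 \<in> E then 0 else 1)"
  by (cases k; cases "k - 1") auto

lemma bnd_cong:
  "(\<And>j. j \<le> k \<Longrightarrow> j \<in> E \<longleftrightarrow> j \<in> E') \<Longrightarrow> bnd h E k = bnd h E' k"
  by (induction h E k rule: bnd.induct) auto

lemma bnd_pos: "h \<ge> 1 \<Longrightarrow> k \<ge> 1 \<Longrightarrow> bnd h E k \<ge> 1"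
proof -
  have "h \<ge> 1 \<Longrightarrow> bnd h E (Suc k) \<ge> 1 \<and> bnd h E (Suc (Suc k)) \<ge> bnd h E (Suc k)" for k
    by (induction k) auto
  then show "h \<ge> 1 \<Longrightarrow> k \<ge> 1 \<Longrightarrow> bnd h E k \<ge> 1" by (cases k) auto
qed

lemma bnd_mono: "h \<ge> 1 \<Longrightarrow> k \<le> l \<Longrightarrow> bnd h E k \<le> bnd h E l"
proof (rule lift_Suc_mono_le[of "bnd h E"])
  fix k
  show "h \<ge> 1 \<Longrightarrow> bnd h E k \<le> bnd h E (Suc k)"
    using bnd_rec[of k h E] bnd_pos[of h "k - 1" E] 
    by (cases k; cases "k - 1") auto
qed

text \<open>The recurrence is linear: a unit subtracted at index \<open>j\<close> propagates like a
  Fibonacci sequence starting at \<open>j\<close> and costs \<open>fib (k + 1 - j)\<close> at index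
  \<open>k\<close>.\<close>

lemma bnd_closed_form:
  "bnd h E k = int (h * fib k) - (\<Sum>j\<in>{3..k} - E. int (fib (k + 1 - j)))"
proof (induction h E k rule: bnd.induct)
  case (4 h E k)
  let ?k = "Suc (Suc (Suc k))"
  have s: "{3..Suc (Suc k)} = insert (Suc (Suc k)) {3..Suc k} - (if k = 0 then {2} else {})"
    by auto
  \<comment> \<open>The additional index \<open>Suc (Suc k)\<close> contributes
    \<open>fib 0 = 0\<close>.\<close>
  have a: "(\<Sum>j\<in>{3..Suc (Suc k)} - E. int (fib (Suc (Suc k) - j))) =
        (\<Sum>j\<in>{3..Suc k} - E. int (fib (Suc k + 1 - j)))"
    by (intro sum.mono_neutral_cong_right) (auto simp: le_Suc_eq)
  have "(\<Sum>j\<in>{3..?k} - E. int (fib (?k + 1 - j))) =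
     (\<Sum>j\<in>{3..Suc (Suc k)} - E. int (fib (?k + 1 - j))) + (if ?k \<in> E then 0 else 1)"
  proof (cases "?k \<in> E")
    case True
    then have "{3..?k} - E = {3..Suc (Suc k)} - E" by (auto simp: le_Suc_eq)
    then show ?thesis using True by simp
  next
    case False
    then have "{3..?k} - E = insert ?k ({3..Suc (Suc k)} - E)" by (auto simp: le_Suc_eq)
    then show ?thesis using False by simp
  qed
  also have "(\<Sum>j\<in>{3..Suc (Suc k)} - E. int (fib (?k + 1 - j))) =
     (\<Sum>j\<in>{3..Suc (Suc k)} - E. int (fib (Suc (Suc k) + 1 - j)) + int (fib (Suc (Suc k) - j)))"
    by (intro sum.cong refl) (auto simp: Suc_diff_le)
  finally show ?case using 4 a by (simp add: sum.distrib algebra_simps)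
qed auto

text \<open>A set of at least \<open>Suc t\<close> positive integers has its maximum at
  \<open>Suc t\<close> or beyond; split off that maximum and use monotonicity of
  \<open>fib\<close>.\<close>

lemma sum_fib_le:
  assumes "finite S" and "t \<le> card S" and "0 \<notin> S"
  shows "(\<Sum>i\<in>{1..t}. fib i) \<le> (\<Sum>i\<in>S. fib i)"
  using assms
proof (induction t arbitrary: S)
  case (Suc t)
  from Suc.prems have "S \<noteq> {}" by auto
  with Suc.prems have M: "Max S \<in> S" by simp
  have "S \<subseteq> {1..Max S}"
  proof
    fix x
    assume "x \<in> S"
    moreover from this Suc.prems(3) have "x \<noteq> 0" by metis
    ultimately show "x \<in> {1..Max S}" using Suc.prems(1) by simp
  qed
  from card_mono[OF _ this] have "Suc t \<le> Max S" using Suc.prems by simp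
  then have "fib (Suc t) \<le> fib (Max S)" by (rule fib_mono)
  moreover have "(\<Sum>i\<in>{1..t}. fib i) \<le> (\<Sum>i\<in>S - {Max S}. fib i)"
    using Suc.prems M by (intro Suc.IH) simp_all
  moreover have "(\<Sum>i\<in>S. fib i) = fib (Max S) + (\<Sum>i\<in>S - {Max S}. fib i)"
    using Suc.prems M by (simp add: sum.remove)
  ultimately show ?case by simp
qed simp

text \<open>A loss at index \<open>j\<close> costs \<open>fib (k + 1 - j)\<close>, which never grows
  with \<open>j\<close>. So a budget of \<open>n - 1\<close> exemptions is best spent on the
  earliest indices 3, ..., \<open>n + 1\<close>.\<close>

lemma bnd_le_bnd_initial:
  assumes "E \<subseteq> {3..}" "finite E" "card E < n"
  shows "bnd h E k \<le> bnd h {..n + 1} k"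
proof -
  \<comment> \<open>The losses are reindexed by the Fibonacci number that each one costs. At least
    \<open>(k - 2) - (n - 1)\<close> of them remain.\<close>
  let ?S = "(\<lambda>j. k + 1 - j) ` ({3..k} - E)"
  have inj: "inj_on (\<lambda>j. k + 1 - j) X" if "X \<subseteq> {3..k}" for X
    using that by (auto simp: inj_on_def subset_iff)
  have "card ?S = card ({3..k} - E)" by (rule card_image, rule inj) blast
  moreover have "card {3..k} - card E \<le> card ({3..k} - E)"
    using assms(2) by (rule diff_card_le_card_Diff)
  ultimately have c: "k - n - 1 \<le> card ?S" using assms(3) by auto
  have "(\<Sum>j\<in>{3..k} - {..n + 1}. fib (k + 1 - j)) = (\<Sum>i\<in>(\<lambda>j. k + 1 - j) ` ({3..k} - {..n + 1}). fib i)"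
    by (subst sum.reindex[OF inj]) auto
  also have "\<dots> \<le> (\<Sum>i\<in>{1..k - n - 1}. fib i)" by (intro sum_mono2) auto
  also have "\<dots> \<le> (\<Sum>i\<in>?S. fib i)" using c by (intro sum_fib_le) auto
  also have "\<dots> = (\<Sum>j\<in>{3..k} - E. fib (k + 1 - j))"
    by (subst sum.reindex[OF inj]) auto
  finally have "(\<Sum>j\<in>{3..k} - {..n + 1}. int (fib (k + 1 - j))) \<le> (\<Sum>j\<in>{3..k} - E. int (fib (k + 1 - j)))"
    by (simp flip: of_nat_sum)
  then show ?thesis by (simp add: bnd_closed_form)
qed


section \<open>Weights along a branch of the algorithm\<close>

text \<open>For positive \<open>c\<close> these are the incomparable pairs over one indeterminate
  whose least common derivative has weight exactly \<open>w(u) + w(v)\<close>.\<close>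

definition axes_pair :: "('m, 'n) dvar \<Rightarrow> ('m, 'n) dvar \<Rightarrow> bool" where
  "axes_pair u v \<longleftrightarrow> snd u = snd v \<and> \<not> below u v \<and> \<not> below v u \<and> (\<forall>i. fst u i = 0 \<or> fst v i = 0)"

definition pure_power :: "('m, 'n) dvar \<Rightarrow> bool" where
  "pure_power v \<longleftrightarrow> (\<exists>i. \<forall>j. j \<noteq> i \<longrightarrow> fst v j = 0)"

text \<open>Weights replace degrees here because the recurrence for the bounds comes from weights;
  the shift to \<open>i + 1\<close> agrees with \<open>bounds_degree_growth\<close>.\<close>

definition weight_chain ::
    "('m \<Rightarrow> nat) \<Rightarrow> (nat \<Rightarrow> int) \<Rightarrow> nat \<Rightarrow> ('m::finite, 'n) dvar list \<Rightarrow> bool" where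
  "weight_chain c b k ss \<longleftrightarrow>
     length ss = k \<and> antichain_seq ss \<and> (\<forall>i<k. int (weight_var c (ss ! i)) \<le> b (i + 1))"

text \<open>
  For two derivations, each exceptional index \<open>j\<close> is charged to an indeterminate \<open>Y j\<close> of which
  a power of either derivation has become a leader. The bound on the later pure powers
  makes \<open>Y\<close> injective.
\<close>

definition exceptional ::
    "('m \<Rightarrow> nat) \<Rightarrow> nat \<Rightarrow> nat \<Rightarrow> nat set \<Rightarrow> ('m::finite, 'n::finite) dvar set \<Rightarrow> bool" where
  "exceptional c h K E V \<longleftrightarrow>
     (if CARD('m) = 2 then
        E \<subseteq> {3..K + 1} \<and> card E < CARD('n) \<and>
        (\<exists>Y. inj_on Y E \<and>
          (\<forall>j\<in>E. (\<exists>u\<in>V. \<exists>v\<in>V. snd u = Y j \<and> axes_pair u v) \<and>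
            (\<forall>x\<in>V. snd x = Y j \<longrightarrow> pure_power x \<longrightarrow> int (weight_var c x) \<le> bnd h E (j - 1))))
      else E = UNIV)"

text \<open>
  \<open>P\<close> is the current set of leaders and \<open>V\<close> the set of all leaders met so far on the branch.
  The chain \<open>C k\<close> is the antichain sequence of length \<open>k\<close> that was available when the weights
  first exceeded \<open>bnd h E k\<close>. A leader found later is not above any member of \<open>C k\<close>, as it
  is reduced, and if its weight exceeds \<open>bnd h E k\<close>, it is not below any of them either.
\<close>

definition stage ::
    "('m \<Rightarrow> nat) \<Rightarrow> nat \<Rightarrow> nat \<Rightarrow> nat set \<Rightarrow> (nat \<Rightarrow> ('m::finite, 'n::finite) dvar list) \<Rightarrow>
     ('m, 'n) dvar set \<Rightarrow> ('m, 'n) dvar set \<Rightarrow> bool" where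
  "stage c h K E C V P \<longleftrightarrow>
     (h = 0 \<longrightarrow> K = 0) \<and> P \<subseteq> V \<and> (\<forall>v\<in>V. \<exists>p\<in>P. below p v) \<and>
     (\<forall>v\<in>V. int (weight_var c v) \<le> bnd h E (K + 1)) \<and>
     (\<forall>k\<le>K. weight_chain c (bnd h E) k (C k) \<and>
        (\<forall>s\<in>set (C k). (\<exists>p\<in>P. below p s) \<and>
           (\<forall>v\<in>V. bnd h E k < int (weight_var c v) \<longrightarrow> \<not> below s v))) \<and>
     exceptional c h K E V"

lemma stageD:
  assumes "stage c h K E C V P"
  shows "P \<subseteq> V" and "v \<in> V \<Longrightarrow> \<exists>p\<in>P. below p v"
    and "v \<in> V \<Longrightarrow> int (weight_var c v) \<le> bnd h E (K + 1)"
    and "k \<le> K \<Longrightarrow> weight_chain c (bnd h E) k (C k)"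
    and "k \<le> K \<Longrightarrow> s \<in> set (C k) \<Longrightarrow> \<exists>p\<in>P. below p s"
    and "k \<le> K \<Longrightarrow> s \<in> set (C k) \<Longrightarrow> v \<in> V \<Longrightarrow> bnd h E k < int (weight_var c v) \<Longrightarrow> \<not> below s v"
    and "exceptional c h K E V" and "h = 0 \<Longrightarrow> K = 0"
  using assms unfolding stage_def by blast+

section \<open>Extending the chains of a stage\<close>

lemma weight_var_eq_0_iff:
  assumes "\<forall>i. 0 < c i"
  shows "weight_var c v = 0 \<longleftrightarrow> (\<forall>i. fst v i = 0)"
proof -
  have "c i * fst v i = 0 \<longleftrightarrow> fst v i = 0" for i using assms[rule_format, of i] by simp
  then show ?thesis unfolding weight_var_def by simp
qed

text \<open>The weight of the minimum is the exact defect in \<open>weight_lcd_le\<close>, so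
  equality there forces disjoint supports.\<close>

lemma weight_lcd_min:
  "weight_var c (lcd_exp u v, y) + weight_var c (\<lambda>i. min (fst u i) (fst v i), y) =
     weight_var c u + weight_var c v"
  unfolding weight_var_def lcd_exp_def sum.distrib[symmetric]
  by (intro sum.cong refl) (auto simp: max_def min_def)

lemma weight_chain_snoc:
  assumes "weight_chain c b k ss" and "\<And>s. s \<in> set ss \<Longrightarrow> \<not> below s x \<and> \<not> below x s"
    and "int (weight_var c x) \<le> b (k + 1)"
  shows "weight_chain c b (k + 1) (ss @ [x])"
  using assms antichain_seq_snoc[of ss x]
  by (auto simp: weight_chain_def nth_append less_Suc_eq)

lemma weight_chain_bound:
  assumes "weight_chain c (bnd h E) k ss" and "h \<ge> 1" and "s \<in> set ss"
  shows "int (weight_var c s) \<le> bnd h E k"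
proof -
  obtain i where i: "i < k" "s = ss ! i"
    using assms by (auto simp: weight_chain_def in_set_conv_nth)
  then have "int (weight_var c s) \<le> bnd h E (i + 1)"
    using assms(1) by (simp add: weight_chain_def)
  also have "\<dots> \<le> bnd h E k" using i assms(2) by (intro bnd_mono) auto
  finally show ?thesis .
qed

lemma not_below_of_weight: "weight_var c s < weight_var c x \<Longrightarrow> \<not> below x s"
  using weight_var_mono[of x s c] by auto

text \<open>All of \<open>V\<close> still has weight at most \<open>bnd h E (K + 1)\<close>, so for
  the new chain the clause on heavier leaders is vacuous; it only has to be dominated by current
  leaders.\<close>

lemma stage_Suc:
  assumes st: "stage c h K E C V P" and h: "h \<ge> 1"
    and ch: "weight_chain c (bnd h E) (K + 1) ss" and dom: "\<And>s. s \<in> set ss \<Longrightarrow> \<exists>p\<in>P. below p s"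
  shows "stage c h (K + 1) E (C(K + 1 := ss)) V P"
proof -
  have V: "\<forall>v\<in>V. int (weight_var c v) \<le> bnd h E (K + 1)"
    using st by (simp add: stage_def)
  moreover have "bnd h E (K + 1) \<le> bnd h E (K + 1 + 1)"
    using h by (intro bnd_mono) auto
  ultimately have "\<forall>v\<in>V. int (weight_var c v) \<le> bnd h E (K + 1 + 1)" by fastforce
  moreover have "exceptional c h (K + 1) E V"
    using st unfolding stage_def exceptional_def
    by (auto split: if_splits) 
  moreover have "\<forall>k\<le>K + 1. weight_chain c (bnd h E) k ((C(K + 1 := ss)) k) \<and>
        (\<forall>s\<in>set ((C(K + 1 := ss)) k). (\<exists>p\<in>P. below p s) \<and>
           (\<forall>v\<in>V. bnd h E k < int (weight_var c v) \<longrightarrow> \<not> below s v))"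
  proof (intro allI impI)
    fix k
    assume "k \<le> K + 1"
    then consider "k \<le> K" | "k = K + 1" by linarith
    then show "weight_chain c (bnd h E) k ((C(K + 1 := ss)) k) \<and>
        (\<forall>s\<in>set ((C(K + 1 := ss)) k). (\<exists>p\<in>P. below p s) \<and>
           (\<forall>v\<in>V. bnd h E k < int (weight_var c v) \<longrightarrow> \<not> below s v))"
    proof cases
      case 1
      then show ?thesis using st by (simp add: stage_def)
    next
      case 2
      then show ?thesis using ch dom V by fastforce
    qed
  qed
  ultimately show ?thesis using st h unfolding stage_def by simp
qed

text \<open>\<open>x\<close> outweighs every term of \<open>C K\<close>, so it lies below none of
  them; the stage itself forbids a term below \<open>x\<close>. Hence \<open>x\<close> can be
  appended.\<close>

lemma stage_extend_heavy:
  assumes st: "stage c h K E C V P" and h: "h \<ge> 1"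
    and x: "x \<in> V" "bnd h E K < int (weight_var c x)"
  shows "\<exists>C'. stage c h (K + 1) E C' V P"
proof -
  have ch: "weight_chain c (bnd h E) K (C K)"
    and s: "\<And>s. s \<in> set (C K) \<Longrightarrow> (\<exists>p\<in>P. below p s) \<and> \<not> below s x"
    and xP: "\<exists>p\<in>P. below p x" and wx: "int (weight_var c x) \<le> bnd h E (K + 1)"
    using st x by (auto simp: stage_def)
  have "\<not> below x s" if "s \<in> set (C K)" for s
    using weight_chain_bound[OF ch h that] x(2) by (intro not_below_of_weight[of c]) simp
  then have "weight_chain c (bnd h E) (K + 1) (C K @ [x])"
    using ch s wx by (intro weight_chain_snoc) auto
  from stage_Suc[OF st h this] s xP show ?thesis by auto
qed

text \<open>If one of \<open>u\<close>, \<open>v\<close> outweighs \<open>bnd h E K\<close>, it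
  extends \<open>C K\<close>. Otherwise both outweigh \<open>bnd h E (K - 1)\<close>, and
  \<open>C (K - 1)\<close> is extended by the two together.\<close>

lemma stage_extend_pair:
  assumes st: "stage c h K E C V P" and h: "h \<ge> 1"
    and uv: "u \<in> V" "v \<in> V" "\<not> below u v" "\<not> below v u"
    and sum: "K \<le> 1 \<or> bnd h E K + bnd h E (K - 1) < int (weight_var c u) + int (weight_var c v)"
  shows "\<exists>C'. stage c h (K + 1) E C' V P"
proof -
  have dom: "\<exists>p\<in>P. below p u" "\<exists>p\<in>P. below p v"
    and w: "int (weight_var c u) \<le> bnd h E (K + 1)" "int (weight_var c v) \<le> bnd h E (K + 1)"
    using st uv by (auto simp: stage_def)
  consider "K = 0" | "bnd h E K < int (weight_var c u)" | "bnd h E K < int (weight_var c v)"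
    | "K \<ge> 1" "int (weight_var c u) \<le> bnd h E K" "int (weight_var c v) \<le> bnd h E K"
    by linarith
  then show ?thesis
  proof cases
    case 1
    then have "weight_chain c (bnd h E) (K + 1) [u]"
      using w by (simp add: weight_chain_def antichain_seq_def)
    from stage_Suc[OF st h this] dom show ?thesis by auto
  next
    case 2
    then show ?thesis using stage_extend_heavy[OF st h uv(1)] by blast
  next
    case 3
    then show ?thesis using stage_extend_heavy[OF st h uv(2)] by blast
  next
    case 4
    let ?ss = "C (K - 1)"
    have K1: "K - 1 \<le> K" by simp
    note ch = stageD(4)[OF st K1] and s = stageD(5,6)[OF st K1]
    have incomp: "\<not> below s x \<and> \<not> below x s" if "s \<in> set ?ss" "x = u \<or> x = v" for s x
    proof -
      \<comment> \<open>For \<open>K = 1\<close> the chain \<open>C 0\<close> is empty, so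
        incomparability of \<open>u\<close> and \<open>v\<close> is enough and no weight condition
        is called for.\<close>
      have "K \<noteq> 1" using that(1) ch by (auto simp: weight_chain_def)
      then have "bnd h E (K - 1) < int (weight_var c x)"
        using sum 4 that(2) by auto
      moreover from this have "\<not> below x s"
        using weight_chain_bound[OF ch h that(1)] by (intro not_below_of_weight[of c]) simp
      ultimately show ?thesis using s(2)[OF that(1)] that(2) uv by blast
    qed
    have "weight_chain c (bnd h E) (K - 1 + 1) (?ss @ [u])"
      using 4 incomp by (intro weight_chain_snoc[OF ch]) auto
    then have "weight_chain c (bnd h E) (K - 1 + 1 + 1) ((?ss @ [u]) @ [v])"
    proof (rule weight_chain_snoc)
      fix s
      assume "s \<in> set (?ss @ [u])"
      then show "\<not> below s v \<and> \<not> below v s" using incomp[of s v] uv by auto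
    qed (use 4 w in simp)
    then have "weight_chain c (bnd h E) (K + 1) (?ss @ [u, v])" using 4 by simp
    from stage_Suc[OF st h this] s(1) dom show ?thesis
      by (auto simp del: split_paired_All split_paired_Ex)
  qed
qed

section \<open>Two derivations: pairs of pure powers\<close>

lemma card_2_UNIV:
  assumes "CARD('m) = 2"
  obtains i j :: "'m::finite" where "i \<noteq> j" and "UNIV = {i, j}"
  using assms by (auto simp: card_2_iff)

text \<open>Disjoint supports would also allow one exponent vector to vanish, but then the two
  derivatives would be comparable.\<close>

lemma axes_pair_cases:
  fixes u v :: "('m, 'n) dvar"
  assumes "axes_pair u v" and "UNIV = {i, j}"
  shows "fst u i = 0 \<and> fst v j = 0 \<or> fst u j = 0 \<and> fst v i = 0"
proof -
  have all: "(\<forall>r :: 'm. Q r) \<longleftrightarrow> Q i \<and> Q j" for Q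
    using assms(2) by (metis UNIV_I insert_iff singletonD)
  show ?thesis
    using assms(1) unfolding axes_pair_def below_def all by auto
qed

lemma axes_pair_pure_power:
  fixes u v :: "('m::finite, 'n) dvar"
  assumes "axes_pair u v" and "CARD('m) = 2"
  shows "pure_power u" and "pure_power v"
proof -
  obtain i j :: 'm where ij: "i \<noteq> j" "UNIV = {i, j}" using card_2_UNIV[OF assms(2)] .
  have all: "(\<forall>r :: 'm. Q r) \<longleftrightarrow> Q i \<and> Q j" and ex: "(\<exists>r :: 'm. Q r) \<longleftrightarrow> Q i \<or> Q j" for Q
    using ij(2) by (metis UNIV_I insert_iff singletonD)+
  show "pure_power u" "pure_power v"
    using axes_pair_cases[OF assms(1) ij(2)] ij(1) unfolding pure_power_def all ex by auto
qed

text \<open>A derivative above neither pure power lies strictly inside the rectangle that they span,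
  and the corner of this rectangle has weight \<open>w(u) + w(v)\<close>.\<close>

lemma axes_pair_box:
  fixes u v z :: "('m::finite, 'n) dvar"
  assumes ap: "axes_pair u v" and two: "CARD('m) = 2" and c: "\<forall>i. 0 < c i"
    and z: "snd z = snd u" "\<not> below u z" "\<not> below v z"
  shows "weight_var c z < weight_var c u + weight_var c v"
proof -
  obtain i j :: 'm where ij: "i \<noteq> j" "UNIV = {i, j}" using card_2_UNIV[OF two] .
  have all: "(\<forall>r :: 'm. Q r) \<longleftrightarrow> Q i \<and> Q j" for Q
    using ij(2) by (metis UNIV_I insert_iff singletonD)
  have w: "weight_var c x = c i * fst x i + c j * fst x j" for x :: "('m, 'n) dvar"
    using ij(1) unfolding weight_var_def ij(2) by simp
  have sv: "snd v = snd u" using ap by (simp add: axes_pair_def)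
  have main: "weight_var c z < weight_var c u' + weight_var c v'"
    if "fst u' j = 0" "fst v' i = 0" "snd u' = snd z" "snd v' = snd z" "\<not> below u' z" "\<not> below v' z"
    for u' v' :: "('m, 'n) dvar"
  proof -
    have "fst z i < fst u' i" "fst z j < fst v' j"
      using that unfolding below_def all by auto
    then have "c i * fst z i < c i * fst u' i" "c j * fst z j < c j * fst v' j"
      using c by auto
    then show ?thesis unfolding w by linarith
  qed
  show ?thesis
    using axes_pair_cases[OF ap ij(2)]
  proof
    assume "fst u i = 0 \<and> fst v j = 0"
    then have "weight_var c z < weight_var c v + weight_var c u"
      using z sv by (intro main) auto
    then show ?thesis by simp
  next
    assume "fst u j = 0 \<and> fst v i = 0"
    then show ?thesis using z sv by (intro main) auto
  qed
qed

text \<open>The order is linear along an axis. The leader \<open>p\<close> or \<open>q\<close> on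
  the axis of \<open>x\<close> is therefore above \<open>x\<close> or below it, and in the latter
  case equal to \<open>x\<close> by reducedness.\<close>

lemma axes_pair_reduced_pure_power:
  fixes u v x :: "('m::finite, 'n) dvar"
  assumes ap: "axes_pair u v" and two: "CARD('m) = 2"
    and x: "pure_power x" "snd x = snd u"
    and pq: "below p u" "below q v" "below p x \<Longrightarrow> x = p" "below q x \<Longrightarrow> x = q"
  shows "below x u \<or> below x v"
proof -
  obtain i j :: 'm where ij: "i \<noteq> j" "UNIV = {i, j}" using card_2_UNIV[OF two] .
  have all: "(\<forall>r :: 'm. Q r) \<longleftrightarrow> Q i \<and> Q j" and ex: "(\<exists>r :: 'm. Q r) \<longleftrightarrow> Q i \<or> Q j" for Q
    using ij(2) by (metis UNIV_I insert_iff singletonD)+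
  have s: "snd v = snd u" "snd p = snd u" "snd q = snd u"
    using ap pq by (auto simp: axes_pair_def below_def)
  have x0: "fst x i = 0 \<or> fst x j = 0"
    using x(1) ij(1) unfolding pure_power_def all ex by auto
  have lin: "below x t \<or> below t x"
    if "fst x r = 0" "fst t r = 0" "r = i \<or> r = j" "snd t = snd u" for r and t :: "('m, 'n) dvar"
    using that x(2) unfolding below_def all by auto
  have p0: "fst u r = 0 \<Longrightarrow> fst p r = 0" and q0: "fst v r = 0 \<Longrightarrow> fst q r = 0" for r
    using pq(1,2) by (metis below_def le_zero_eq)+
  have "below x p \<or> below x q"
    using axes_pair_cases[OF ap ij(2)] x0 lin[of _ p] lin[of _ q] p0 q0 pq(3,4) s below_refl
    by metis
  then show ?thesis using pq(1,2) below_trans by blast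
qed

text \<open>
  If no longer chain exists, then \<open>u\<close> and \<open>v\<close> are powers of the two derivations applied to
  the same indeterminate, and the bound for \<open>K + 1\<close> is raised by one. The indeterminate of
  \<open>z\<close> is never charged for this, for otherwise \<open>z\<close> would lie in a box spanned by two pure
  powers and be too light; hence fewer than \<open>CARD('n)\<close> indices are exceptional.
\<close>

lemma stage_step:
  fixes V P :: "('m::finite, 'n::finite) dvar set"
  assumes st: "stage c h K E C V P" and c: "\<forall>i. 0 < c i"
    and red: "\<And>p. p \<in> P \<Longrightarrow> below p z \<Longrightarrow> z = p"
    and uv: "u \<in> V" "v \<in> V" "snd u = snd v" "\<not> below u v" "\<not> below v u"
    and z: "weight_var c z \<le> weight_var c (lcd_exp u v, snd u)"
    and big: "bnd h E (K + 1) < int (weight_var c z)"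
  shows "(\<exists>C'. stage c h (K + 1) E C' V P) \<or>
    (K + 1 \<notin> E \<and> bnd h E (K + 1) \<le> bnd h (insert (K + 1) E) (K + 1) \<and>
     stage c h K (insert (K + 1) E) C V P)"
proof -
  let ?w = "\<lambda>v. int (weight_var c v)"
  have V: "?w x \<le> bnd h E (K + 1)" if "x \<in> V" for x
    using stageD(3)[OF st that] .
  have PV: "P \<subseteq> V" and exc: "exceptional c h K E V" using st by (auto simp: stage_def)
  have zV: "\<not> below x z" if "x \<in> V" for x
  proof
    assume "below x z"
    obtain p where p: "p \<in> P" "below p x" using stageD(2)[OF st \<open>x \<in> V\<close>] by blast
    then have "z = p" using red[of p] below_trans[of p x z] \<open>below x z\<close> by blast
    then show False using V[of z] p(1) PV big by auto
  qed
  \<comment> \<open>For \<open>h = 0\<close> all leaders have weight 0, that is, they are underived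
    indeterminates, and \<open>u\<close>, \<open>v\<close> would be comparable.\<close>
  have h: "h \<ge> 1"
  proof (rule ccontr)
    assume "\<not> h \<ge> 1"
    then have "h = 0" "K = 0" using st by (auto simp: stage_def)
    then have "?w u = 0" using V[OF uv(1)] by simp
    then have "\<forall>i. fst u i = 0" using weight_var_eq_0_iff[OF c, of u] by simp
    then show False using uv by (simp add: below_def)
  qed
  have lcd: "?w z \<le> ?w u + ?w v"
    using z weight_lcd_le[of c u v "snd u"] by linarith
  show ?thesis
  proof (cases "K \<le> 1 \<or> bnd h E K + bnd h E (K - 1) < ?w u + ?w v")
    case True
    from stage_extend_pair[OF st h uv(1,2,4,5) this] show ?thesis by blast
  next
    case False
    then have K: "K \<ge> 2" and le: "?w u + ?w v \<le> bnd h E K + bnd h E (K - 1)" by auto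
    have rec: "bnd h E (K + 1) = bnd h E K + bnd h E (K - 1) - (if K + 1 \<in> E then 0 else 1)"
      using bnd_rec[OF K] .
    \<comment> \<open>At an exceptional index nothing is subtracted, so the bound would already be
      at least \<open>w(u) + w(v)\<close>, hence at least the weight of \<open>z\<close>.\<close>
    have KE: "K + 1 \<notin> E" using rec big lcd le by (auto split: if_splits)
    then have two: "CARD('m) = 2" using exc by (auto simp: exceptional_def split: if_splits)
    \<comment> \<open>The bound is just one unit below \<open>bnd h E K + bnd h E (K - 1)\<close>
      and \<open>z\<close> exceeds it, which turns all the inequalities into equalities.\<close>
    have eq: "?w u + ?w v = bnd h E K + bnd h E (K - 1)" "?w z = ?w u + ?w v"
      using rec KE big lcd le by auto
    then have "weight_var c (\<lambda>i. min (fst u i) (fst v i), snd u) = 0"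
      using z weight_lcd_min[of c u v "snd u"] by linarith
    then have "\<forall>i. min (fst u i) (fst v i) = 0"
      by (simp add: weight_var_eq_0_iff[OF c])
    then have "\<forall>i. fst u i = 0 \<or> fst v i = 0" by (metis min_def)
    then have ap: "axes_pair u v" using uv by (simp add: axes_pair_def)
    show ?thesis
    proof (cases "\<exists>C'. stage c h (K + 1) E C' V P")
      case noext: False
      have VK: "?w x \<le> bnd h E K" if "x \<in> V" for x
        using stage_extend_heavy[OF st h that] noext by fastforce
      obtain Y where E: "E \<subseteq> {3..K + 1}" "card E < CARD('n)" "inj_on Y E"
        and Y: "\<And>j. j \<in> E \<Longrightarrow> \<exists>u\<in>V. \<exists>v\<in>V. snd u = Y j \<and> axes_pair u v"
          "\<And>j x. j \<in> E \<Longrightarrow> x \<in> V \<Longrightarrow> snd x = Y j \<Longrightarrow> pure_power x \<Longrightarrow> ?w x \<le> bnd h E (j - 1)"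
        using exc two unfolding exceptional_def by auto
      have jK: "3 \<le> j" "j \<le> K" if "j \<in> E" for j
        using that E(1) KE by (auto simp: subset_iff le_Suc_eq)
      \<comment> \<open>If the indeterminate had been charged at \<open>j\<close>, then
        \<open>w(u) + w(v)\<close> would be at most \<open>2 * bnd h E (j - 1)\<close>, which is
        less than \<open>bnd h E j + bnd h E (j - 1)\<close>, contrary to \<open>eq\<close> since
        \<open>j <= K\<close>.\<close>
      have new: "snd u \<noteq> Y j" if j: "j \<in> E" for j
      proof
        assume "snd u = Y j"
        then have "?w u \<le> bnd h E (j - 1)" "?w v \<le> bnd h E (j - 1)"
          using Y(2)[OF j] uv axes_pair_pure_power[OF ap two] by auto
        moreover have "bnd h E j = bnd h E (j - 1) + bnd h E (j - 2)"
          using bnd_rec[of "j - 1" h E] jK[OF j] j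
          by (simp add: numeral_2_eq_2 diff_diff_left)
        moreover have "1 \<le> bnd h E (j - 2)" using h jK[OF j] by (intro bnd_pos) auto
        moreover have "bnd h E j \<le> bnd h E K" "bnd h E (j - 1) \<le> bnd h E (K - 1)"
          using jK[OF j] h by (auto intro!: bnd_mono)
        ultimately show False using eq by linarith
      qed
      \<comment> \<open>By \<open>axes_pair_box\<close> such a pair would weigh more than
        \<open>z\<close> in total, enough for \<open>stage_extend_pair\<close>, although no longer
        chain exists.\<close>
      have open_z: "\<not> (\<exists>u'\<in>V. \<exists>v'\<in>V. snd u' = snd z \<and> axes_pair u' v')"
      proof
        assume "\<exists>u'\<in>V. \<exists>v'\<in>V. snd u' = snd z \<and> axes_pair u' v'"
        then obtain u' v' where uv': "u' \<in> V" "v' \<in> V" "snd u' = snd z" "axes_pair u' v'" by blast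
        then have "weight_var c z < weight_var c u' + weight_var c v'"
          using two c zV by (intro axes_pair_box) auto
        then have "bnd h E K + bnd h E (K - 1) < ?w u' + ?w v'" using eq by linarith
        with stage_extend_pair[OF st h uv'(1,2)] uv'(4) noext
        show False by (auto simp: axes_pair_def)
      qed
      let ?E = "insert (K + 1) E" and ?Y = "Y(K + 1 := snd u)"
      \<comment> \<open>Values up to index \<open>K\<close> do not consult \<open>K + 1\<close>, so
        the chains built so far survive the change of \<open>E\<close>.\<close>
      have cong: "bnd h ?E k = bnd h E k" if "k \<le> K" for k
        using that by (intro bnd_cong) auto
      have up: "bnd h E (K + 1) \<le> bnd h ?E (K + 1)"
        using bnd_rec[OF K, of h ?E] rec cong by simp
      have inj: "inj_on ?Y ?E"
        using E(3) KE new new[symmetric] by (auto simp: inj_on_def)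
      have "snd z \<notin> ?Y ` ?E"
        using open_z Y(1) uv(1,2) ap KE by (auto simp: image_iff split: if_splits) metis+
      then have "card (?Y ` ?E) < CARD('n)"
        by (intro psubset_card_mono) auto
      then have card: "card ?E < CARD('n)" using card_image[OF inj] by simp
      have "(\<exists>u\<in>V. \<exists>v\<in>V. snd u = ?Y j \<and> axes_pair u v) \<and>
          (\<forall>x\<in>V. snd x = ?Y j \<longrightarrow> pure_power x \<longrightarrow> ?w x \<le> bnd h ?E (j - 1))" if "j \<in> ?E" for j
      proof (cases "j = K + 1")
        case True
        then show ?thesis using uv ap VK cong[of K] by auto
      next
        case False
        then have j: "j \<in> E" using that by simp
        then have "?Y j = Y j" "bnd h ?E (j - 1) = bnd h E (j - 1)"
          using False jK[OF j] cong[of "j - 1"] by auto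
        then show ?thesis using Y[OF j] by auto
      qed
      then have "exceptional c h K ?E V"
        unfolding exceptional_def if_P[OF two] using E(1) K card inj
        by (intro conjI exI[of _ ?Y] ballI) auto
      moreover have "\<forall>v\<in>V. ?w v \<le> bnd h ?E (K + 1)" using V up by fastforce
      moreover have "weight_chain c (bnd h ?E) k (C k) \<longleftrightarrow> weight_chain c (bnd h E) k (C k)" if "k \<le> K" for k
        using that cong unfolding weight_chain_def by auto
      ultimately have "stage c h K ?E C V P"
        using st cong unfolding stage_def by auto
      then show ?thesis using KE up by blast
    qed blast
  qed
qed

section \<open>Raising the bound to a given weight, and inserting a leader\<close>

lemma stage_reach:
  fixes V P :: "('m::finite, 'n::finite) dvar set"
  assumes "stage c h K E C V P" and c: "\<forall>i. 0 < c i"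
    and red: "\<And>p. p \<in> P \<Longrightarrow> below p z \<Longrightarrow> z = p"
    and uv: "u \<in> V" "v \<in> V" "snd u = snd v" "\<not> below u v" "\<not> below v u"
    and z: "weight_var c z \<le> weight_var c (lcd_exp u v, snd u)"
    and bounded: "\<And>K E C. stage c h K E C V P \<Longrightarrow> K \<le> L"
  shows "\<exists>K' E' C'. stage c h K' E' C' V P \<and> bnd h E (K + 1) \<le> bnd h E' (K' + 1) \<and>
    int (weight_var c z) \<le> bnd h E' (K' + 1)"
  using assms(1)
\<comment> \<open>A step either raises \<open>K\<close>, where the factor 2 pays for
  \<open>K + 2\<close> possibly not being exceptional yet, or makes \<open>K + 1\<close> exceptional
  and removes the second summand.\<close>
proof (induction "2 * (L - K) + (if K + 1 \<in> E then 0 else 1 :: nat)" arbitrary: K E C rule: less_induct)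
  case less
  show ?case
  proof (cases "int (weight_var c z) \<le> bnd h E (K + 1)")
    case True
    then show ?thesis using less.prems by blast
  next
    case False
    then consider C' where "stage c h (K + 1) E C' V P"
      | "K + 1 \<notin> E" "bnd h E (K + 1) \<le> bnd h (insert (K + 1) E) (K + 1)"
        "stage c h K (insert (K + 1) E) C V P"
      using stage_step[OF less.prems c red uv z] by auto
    then show ?thesis
    proof cases
      case 1
      have "K + 1 \<le> L" by (rule bounded[OF 1])
      then have "\<exists>K' E' C'. stage c h K' E' C' V P \<and> bnd h E (K + 1 + 1) \<le> bnd h E' (K' + 1) \<and>
          int (weight_var c z) \<le> bnd h E' (K' + 1)"
        by (intro less.hyps[OF _ 1]) auto
      moreover have "bnd h E (K + 1) \<le> bnd h E (K + 1 + 1)"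
        using 1 by (intro bnd_mono) (auto simp: stage_def Suc_le_eq)
      ultimately show ?thesis by (meson order_trans)
    next
      case 2
      then have "\<exists>K' E' C'. stage c h K' E' C' V P \<and>
          bnd h (insert (K + 1) E) (K + 1) \<le> bnd h E' (K' + 1) \<and>
          int (weight_var c z) \<le> bnd h E' (K' + 1)"
        by (intro less.hyps[OF _ 2(3)]) auto
      with 2(2) show ?thesis by (meson order_trans)
    qed
  qed
qed

lemma stage_insert:
  fixes V P :: "('m::finite, 'n::finite) dvar set"
  assumes st: "stage c h K E C V P"
    and red: "\<And>p. p \<in> P \<Longrightarrow> below p z \<Longrightarrow> z = p"
    and z: "int (weight_var c z) \<le> bnd h E (K + 1)"
  shows "stage c h K E C (insert z V) (insert z {p \<in> P. \<not> below z p})"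
proof -
  let ?P = "insert z {p \<in> P. \<not> below z p}"
  have dom: "\<exists>p\<in>?P. below p x" if "\<exists>p\<in>P. below p x" for x
    using that below_trans[of z _ x] by blast
  \<comment> \<open>The leader dominating \<open>s\<close> would lie below \<open>z\<close> and so
    equal \<open>z\<close>; then \<open>s = z\<close>, and \<open>z\<close> would obey the weight
    bound of the chain \<open>C k\<close>.\<close>
  have "\<not> below s z" if s: "k \<le> K" "s \<in> set (C k)" "bnd h E k < int (weight_var c z)" for s k
  proof
    assume sz: "below s z"
    obtain p where p: "p \<in> P" "below p s" using stageD(5)[OF st s(1,2)] by blast
    then have "z = p" using red below_trans sz by blast
    then have "z = s" using below_antisym p sz by blast
    moreover have "h \<ge> 1"
      using st s by (cases "h = 0") (auto simp: stage_def weight_chain_def)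
    then have "int (weight_var c s) \<le> bnd h E k"
      using st s by (intro weight_chain_bound) (auto simp: stage_def)
    ultimately show False using s by simp
  qed
  moreover have "exceptional c h K E (insert z V)"
  proof (cases "CARD('m) = 2")
    case two: True
    then obtain Y where E: "E \<subseteq> {3..K + 1}" "card E < CARD('n)" "inj_on Y E"
      and Y: "\<And>j. j \<in> E \<Longrightarrow> \<exists>u\<in>V. \<exists>v\<in>V. snd u = Y j \<and> axes_pair u v"
        "\<And>j x. j \<in> E \<Longrightarrow> x \<in> V \<Longrightarrow> snd x = Y j \<Longrightarrow> pure_power x \<Longrightarrow>
           int (weight_var c x) \<le> bnd h E (j - 1)"
      using st unfolding exceptional_def stage_def by auto
    \<comment> \<open>A new pure power over a charged indeterminate divides one of the two charged
      powers, so it inherits their weight bound.\<close>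
    have "int (weight_var c z) \<le> bnd h E (j - 1)" if j: "j \<in> E" "snd z = Y j" "pure_power z" for j
    proof -
      obtain u v where uv: "u \<in> V" "v \<in> V" "snd u = Y j" "axes_pair u v" using Y(1)[OF j(1)] by blast
      obtain p q where pq: "p \<in> P" "q \<in> P" "below p u" "below q v"
        using st uv unfolding stage_def by meson
      have "below z u \<or> below z v"
        using axes_pair_reduced_pure_power[OF uv(4) two j(3) _ pq(3,4)] red pq uv j by auto
      then have "weight_var c z \<le> weight_var c u \<or> weight_var c z \<le> weight_var c v"
        using weight_var_mono by blast
      moreover have "int (weight_var c u) \<le> bnd h E (j - 1)" "int (weight_var c v) \<le> bnd h E (j - 1)"
        using Y(2)[OF j(1)] uv axes_pair_pure_power[OF uv(4) two] by (auto simp: axes_pair_def)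
      ultimately show ?thesis by linarith
    qed
    then have "\<forall>j\<in>E. (\<exists>u\<in>insert z V. \<exists>v\<in>insert z V. snd u = Y j \<and> axes_pair u v) \<and>
        (\<forall>x\<in>insert z V. snd x = Y j \<longrightarrow> pure_power x \<longrightarrow> int (weight_var c x) \<le> bnd h E (j - 1))"
      using Y by blast
    then show ?thesis unfolding exceptional_def using two E by auto
  next
    case False
    then show ?thesis using st by (simp add: exceptional_def stage_def)
  qed
  ultimately show ?thesis
    using st z dom below_refl[of z] unfolding stage_def by (auto simp: subset_iff)
qed

section \<open>The first stage, and bounds valid at every stage\<close>

lemma stage_initial:
  "stage c h 0 (if CARD('m) = 2 then {} else UNIV) (\<lambda>_. []) {}
     ({} :: ('m::finite, 'n::finite) dvar set)"
  by (auto simp: stage_def exceptional_def weight_chain_def)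

lemma stage_bounds:
  fixes V P :: "('m::finite, 'n::finite) dvar set"
  assumes st: "stage c h K E C V P" and c: "\<forall>i. 0 < c i"
    and f: "f = bnd h (if CARD('m) = 2 then {..CARD('n) + 1} else UNIV)"
  shows "K \<le> max_antichain_length TYPE('m) TYPE('n) f"
    and "bnd h E (K + 1) \<le> f (max_antichain_length TYPE('m) TYPE('n) f + 1)"
proof -
  let ?L = "max_antichain_length TYPE('m) TYPE('n) f"
  have le: "bnd h E k \<le> f k" for k
  proof (cases "CARD('m) = 2")
    case True
    then have E: "E \<subseteq> {3..K + 1}" "card E < CARD('n)" using st by (auto simp: stage_def exceptional_def)
    then have "E \<subseteq> {3..}" "finite E" by (auto intro: finite_subset)
    then show ?thesis using True E(2) bnd_le_bnd_initial[of E "CARD('n)" h k] unfolding f by simp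
  next
    case False
    then show ?thesis using st f by (simp add: stage_def exceptional_def)
  qed
  have ch: "weight_chain c (bnd h E) K (C K)" using st by (simp add: stage_def)
  have "bounds_degree_growth f (C K)"
    unfolding bounds_degree_growth_def
  proof (intro allI impI)
    fix i
    assume "i < length (C K)"
    then have "int (weight_var c (C K ! i)) \<le> bnd h E (i + 1)"
      using ch by (simp add: weight_chain_def)
    then show "int (ord_var (C K ! i)) \<le> f (i + 1)"
      using le[of "i + 1"] ord_var_le_weight_var[OF c, of "C K ! i"] by linarith
  qed
  then show K: "K \<le> ?L"
    using length_le_max_antichain_length[of "C K" f] ch by (simp add: weight_chain_def)
  show "bnd h E (K + 1) \<le> f (?L + 1)"
  proof (cases "h = 0")
    case False
    then have "f (K + 1) \<le> f (?L + 1)" unfolding f using K f by (intro bnd_mono) auto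
    then show ?thesis using le[of "K + 1"] by simp
  next
    case True
    then have "K = 0" using st by (simp add: stage_def)
    then have "bnd h E (K + 1) = 0" using True by simp
    \<comment> \<open>For \<open>h = 0\<close> and two derivations \<open>f\<close> is negative from
      \<open>CARD('n) + 2\<close> on, so \<open>?L <= CARD('n)\<close> is needed. All terms of a
      sequence have degree 0, and being incomparable they involve distinct indeterminates.\<close>
    moreover have "0 \<le> f (?L + 1)"
    proof (cases "CARD('m) = 2")
      case False
      then show ?thesis using f fib_eq_bnd[of h] True by simp
    next
      case two: True
      obtain ss :: "('m, 'n) dvar list" where ss: "antichain_seq ss" "bounds_degree_growth f ss" "length ss = ?L"
        using max_antichain_length_attained by blast
      have f0: "bnd 0 {..n + 1} k \<le> 0 \<and> (k \<le> n + 1 \<longrightarrow> bnd 0 {..n + 1} k = 0)" for n k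
        by (induction "0 :: nat" "{..n + 1}" k rule: bnd.induct) auto
      have zero: "fst (ss ! i) r = 0" if "i < ?L" for i r
      proof -
        have "int (ord_var (ss ! i)) \<le> f (i + 1)" using ss that by (simp add: bounds_degree_growth_def)
        also have "\<dots> \<le> 0" using f0[of "CARD('n)" "i + 1"] f two True by simp
        finally have "ord_var (ss ! i) = 0" by simp
        then show ?thesis by (simp add: ord_var_def)
      qed
      have "inj_on (\<lambda>i. snd (ss ! i)) {..<?L}"
      proof (rule inj_onI)
        fix i j
        assume ij: "i \<in> {..<?L}" "j \<in> {..<?L}" "snd (ss ! i) = snd (ss ! j)"
        then have "below (ss ! i) (ss ! j)" using zero by (simp add: below_def)
        then show "i = j" using ss(1,3) ij unfolding antichain_seq_def by auto
      qed
      then have "card {..<?L} \<le> CARD('n)" by (rule card_inj_on_le) auto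
      then show ?thesis using f0[of "CARD('n)" "?L + 1"] f two True by simp
    qed
    ultimately show ?thesis by simp
  qed
qed


section \<open>Derivatives occurring in differential polynomials\<close>

lemma vars_zero [simp]: "vars (0 :: ('m, 'n, 'k::comm_ring_1) dpoly) = {}"
  by (simp add: vars_def)

lemma vars_Const [simp]: "vars (Const a :: ('m, 'n, 'k::comm_ring_1) dpoly) = {}"
  by (simp add: vars_def Const_def)

lemma vars_one [simp]: "vars (1 :: ('m, 'n, 'k::comm_ring_1) dpoly) = {}"
  by (simp add: vars_def)

lemma vars_Var [simp]: "vars (Var v :: ('m, 'n, 'k::comm_ring_1) dpoly) = {v}"
  by (simp add: vars_def Var_def)

lemma vars_uminus [simp]: "vars (- f) = vars f"
  by (simp add: vars_def in_keys_iff set_eq_iff Poly_Mapping.lookup_uminus)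

lemma vars_diff: "vars (f - g) \<subseteq> vars f \<union> vars g"
  using vars_add[of f "- g"] by simp

lemma vars_sum: "vars (\<Sum>x\<in>X. F x) \<subseteq> (\<Union>x\<in>X. vars (F x))"
  using vars_add by (induction X rule: infinite_finite_induct) fastforce+

lemma vars_power: "vars (f ^ k) \<subseteq> vars f"
  using vars_mult by (induction k) fastforce+

lemma vars_of_nat [simp]: "vars (of_nat k :: ('m, 'n, 'k::comm_ring_1) dpoly) = {}"
  using vars_add by (induction k) fastforce+

lemma vars_eq_empty_iff: "vars f = {} \<longleftrightarrow> f \<in> ground"
proof
  assume "vars f = {}"
  then have "Poly_Mapping.keys f \<subseteq> {0}"
    by (auto simp: vars_def)
  then have "Poly_Mapping.lookup f \<mu> = 0" if "\<mu> \<noteq> 0" for \<mu>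
    using that by (auto simp: in_keys_iff)
  then have "f = Const (Poly_Mapping.lookup f 0)"
    unfolding Const_def by (intro poly_mapping_eqI) (auto simp: lookup_single when_def)
  then show "f \<in> ground" by (auto simp: ground_def)
qed (auto simp: ground_def)

lemma keys_minus_subset: "Poly_Mapping.keys (\<mu> - \<nu> :: 'a \<Rightarrow>\<^sub>0 nat) \<subseteq> Poly_Mapping.keys \<mu>"
  by (auto simp: in_keys_iff lookup_minus)

lemma vars_single_minus:
  assumes "\<mu> \<in> Poly_Mapping.keys f"
  shows "vars (Poly_Mapping.single (\<mu> - \<nu>) a) \<subseteq> vars f"
  using assms keys_minus_subset[of \<mu> \<nu>] by (auto simp: vars_def)

lemma vars_coeff_in: "vars (coeff_in v e f) \<subseteq> vars f"
  unfolding coeff_in_def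
  by (rule order_trans[OF vars_sum]) (auto dest: subsetD[OF vars_single_minus])

lemma vars_partial_deriv: "vars (partial_deriv v f) \<subseteq> vars f"
  unfolding partial_deriv_def
  by (rule order_trans[OF vars_sum]) (auto dest: subsetD[OF vars_single_minus])

lemma vars_map: "vars (Poly_Mapping.map g f) \<subseteq> vars f"
  by (auto simp: vars_def in_keys_iff Poly_Mapping.map.rep_eq when_def split: if_splits)

lemma vars_deriv_poly:
  "vars (deriv_poly d i f) \<subseteq> vars f \<union> theta_var (\<lambda>j. if j = i then 1 else 0) ` vars f"
proof -
  let ?t = "theta_var (\<lambda>j. if j = i then 1 else 0)"
  have "vars (partial_deriv v f * Var (?t v)) \<subseteq> vars f \<union> ?t ` vars f" if "v \<in> vars f" for v
    using that vars_partial_deriv[of v f] vars_mult[of "partial_deriv v f" "Var (?t v)"] by auto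
  then have "vars (\<Sum>v\<in>vars f. partial_deriv v f * Var (?t v)) \<subseteq> vars f \<union> ?t ` vars f"
    by (intro order_trans[OF vars_sum] UN_least)
  then show ?thesis
    unfolding deriv_poly_def
    by (intro order_trans[OF vars_add] Un_least order_trans[OF vars_map] Un_upper1)
qed


section \<open>Weights of differential polynomials\<close>

text \<open>The bound is an integer to match \<open>bnd\<close>. Elements of the ground field
  satisfy it for every \<open>B\<close>, even a negative one.\<close>

definition weight_le :: "('m \<Rightarrow> nat) \<Rightarrow> int \<Rightarrow> ('m::finite, 'n, 'k::comm_ring_1) dpoly \<Rightarrow> bool" where
  "weight_le c B f \<longleftrightarrow> (\<forall>v\<in>vars f. int (weight_var c v) \<le> B)"

lemma weight_le_mono: "weight_le c B f \<Longrightarrow> B \<le> B' \<Longrightarrow> weight_le c B' f"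
  by (fastforce simp: weight_le_def)

lemma weight_le_vars_subset: "weight_le c B f \<Longrightarrow> vars g \<subseteq> vars f \<Longrightarrow> weight_le c B g"
  by (auto simp: weight_le_def)

lemma weight_le_diff: "weight_le c B f \<Longrightarrow> weight_le c B g \<Longrightarrow> weight_le c B (f - g)"
  using vars_diff by (fastforce simp: weight_le_def)

lemma weight_le_mult: "weight_le c B f \<Longrightarrow> weight_le c B g \<Longrightarrow> weight_le c B (f * g)"
  using vars_mult by (fastforce simp: weight_le_def)

lemma weight_le_deriv_poly:
  assumes "weight_le c B f"
  shows "weight_le c (B + int (c i)) (deriv_poly d i f)"
proof -
  have shift: "weight_var c (theta_var (\<lambda>j. if j = i then 1 else 0) v) = weight_var c v + c i" for v
  proof -
    have "weight_var c (theta_var (\<lambda>j. if j = i then 1 else 0) v) =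
      (\<Sum>j\<in>UNIV. c j * fst v j + (if j = i then c j else 0))"
      unfolding weight_var_def theta_var_def by (intro sum.cong) auto
    then show ?thesis by (simp add: sum.distrib weight_var_def)
  qed
  have "int (weight_var c v) \<le> B + int (c i)" if v: "v \<in> vars (deriv_poly d i f)" for v
  proof -
    consider "v \<in> vars f" | u where "u \<in> vars f" "v = theta_var (\<lambda>j. if j = i then 1 else 0) u"
      using vars_deriv_poly[of d i f] v by blast
    then show ?thesis
    proof cases
      case 1
      then have "int (weight_var c v) \<le> B" using assms unfolding weight_le_def by blast
      then show ?thesis by simp
    next
      case 2
      then have "int (weight_var c u) \<le> B" using assms unfolding weight_le_def by blast
      then show ?thesis using shift[of u] 2(2) by simp
    qed
  qed
  then show ?thesis by (simp add: weight_le_def)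
qed

lemma weight_le_theta_poly:
  fixes f :: "('m::finite, 'n, 'k::field) dpoly"
  assumes "differential_field d" and f: "weight_le c B f"
  shows "weight_le c (B + int (\<Sum>i\<in>UNIV. c i * \<theta> i)) (theta_poly d \<theta> f)"
proof -
  interpret comp_fun_commute "\<lambda>i. (deriv_poly d i :: ('m, 'n, 'k) dpoly \<Rightarrow> _) ^^ \<theta> i"
    using assms(1) by (rule comp_fun_commute_deriv_poly)
  have pow: "weight_le c (B + int (c i * k)) ((deriv_poly d i ^^ k) g)"
    if "weight_le c B g" for B i k and g :: "('m, 'n, 'k) dpoly"
    using that by (induction k) (auto simp: algebra_simps dest: weight_le_deriv_poly)
  have "finite X \<Longrightarrow> weight_le c (B + int (\<Sum>i\<in>X. c i * \<theta> i))
      (Finite_Set.fold (\<lambda>i. deriv_poly d i ^^ \<theta> i) f X)" for X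
  proof (induction X rule: finite_induct)
    case (insert i X)
    from pow[OF insert.IH, of i "\<theta> i"] insert.hyps show ?case by (simp add: algebra_simps)
  qed (simp add: f)
  from this[of UNIV] show ?thesis by (simp add: theta_poly_def)
qed

text \<open>A single exponent times \<open>c i\<close> is one summand of the weight;
  \<open>0 <= B\<close> takes care of the default value 0 of \<open>ord_wrt\<close>.\<close>

lemma ord_wrt_le_weight:
  assumes "weight_le c B g" and "0 \<le> B" and "\<forall>i. 0 < c i"
  shows "real (ord_wrt i g) \<le> real_of_int B / real (c i)"
proof -
  have "int (c i) * int (fst v i) \<le> B" if "v \<in> vars g" for v
  proof -
    have "c i * fst v i \<le> weight_var c v"
      unfolding weight_var_def by (rule member_le_sum) auto
    then have "int (c i) * int (fst v i) \<le> int (weight_var c v)" by (metis of_nat_le_iff of_nat_mult)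
    also have "\<dots> \<le> B" using assms(1) that by (simp add: weight_le_def)
    finally show ?thesis .
  qed
  moreover have "ord_wrt i g \<in> insert 0 ((\<lambda>v. fst v i) ` vars g)"
    unfolding ord_wrt_def by (rule Max_in) auto
  ultimately have "int (c i) * int (ord_wrt i g) \<le> B" using assms(2) by auto
  then have "real_of_int (int (c i) * int (ord_wrt i g)) \<le> real_of_int B" by (simp only: of_int_le_iff)
  then show ?thesis
    using assms(3)[rule_format, of i] by (simp add: pos_le_divide_eq mult.commute)
qed


section \<open>Leaders\<close>

lemma lead_props:
  assumes lt: "ranking lt" and f: "f \<notin> ground"
  shows "lead lt f \<in> vars f" and "\<And>u. u \<in> vars f \<Longrightarrow> u \<noteq> lead lt f \<Longrightarrow> lt u (lead lt f)"
proof -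
  have lt': "irreflp lt" "transp lt" "totalp lt" using lt by (auto simp: ranking_def)
  have "vars f \<noteq> {}" using f by (simp add: vars_eq_empty_iff)
  then have "\<exists>v\<in>vars f. \<forall>u\<in>vars f. u \<noteq> v \<longrightarrow> lt u v"
    using lt' by (intro Finite_Set.bex_greatest_element) (auto intro: transp_on_subset totalp_on_subset)
  then obtain v where v: "v \<in> vars f" "\<forall>u\<in>vars f. u \<noteq> v \<longrightarrow> lt u v" by blast
  have "lead lt f = v"
    unfolding lead_def
  proof (rule the_equality)
    fix w
    assume "w \<in> vars f \<and> (\<forall>u\<in>vars f. u \<noteq> w \<longrightarrow> lt u w)"
    then show "w = v" using v lt' by (metis irreflpD transpD)
  qed (use v in blast)
  with v show "lead lt f \<in> vars f" "\<And>u. u \<in> vars f \<Longrightarrow> u \<noteq> lead lt f \<Longrightarrow> lt u (lead lt f)"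
    by auto
qed

lemma lead_Var [simp]: "lead lt (Var v :: ('m, 'n, 'k::comm_ring_1) dpoly) = v"
  unfolding lead_def by (rule the_equality) auto

lemma Var_notin_ground: "(Var v :: ('m, 'n, 'k::comm_ring_1) dpoly) \<notin> ground"
  by (simp flip: vars_eq_empty_iff)

lemma deg_in_pos: "v \<in> vars f \<Longrightarrow> deg_in v f > 0"
proof -
  assume "v \<in> vars f"
  then obtain \<mu> where \<mu>: "\<mu> \<in> Poly_Mapping.keys f" "Poly_Mapping.lookup \<mu> v > 0"
    by (auto simp: vars_def in_keys_iff)
  then have "Poly_Mapping.lookup \<mu> v \<le> deg_in v f"
    unfolding deg_in_def by (intro Max_ge) auto
  with \<mu> show ?thesis by simp
qed

lemma deg_in_eq_0: "v \<notin> vars f \<Longrightarrow> deg_in v f = 0"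
  unfolding deg_in_def by (rule Max_eqI) (auto simp: vars_def in_keys_iff)

text \<open>Ranks are compared as polynomials, and the leader can be read off the monomial because
  its exponent is positive.\<close>

lemma lead_eq_of_rank_eq:
  assumes lt: "ranking lt" and f: "f \<notin> ground" and eq: "rank lt f = rank lt g"
  shows "lead lt f = lead lt g"
proof -
  have "Poly_Mapping.single (lead lt f) (lead_deg lt f) = Poly_Mapping.single (lead lt g) (lead_deg lt g)"
    using eq unfolding rank_def Var_power
    by (metis lookup_single_eq lookup_single_not_eq zero_neq_one)
  moreover have "lead_deg lt f > 0"
    unfolding lead_deg_def using lead_props[OF lt f] by (intro deg_in_pos)
  ultimately show ?thesis
    by (metis lookup_single_eq lookup_single_not_eq less_numeral_extra(3))
qed

text \<open>A heavier derivative would rank higher. Thus weight bounds for polynomials become bounds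
  for their leaders, and reductions that do not raise the rank preserve them.\<close>

lemma weight_lead:
  assumes lt: "weighted_ranking c lt" and f: "f \<notin> ground" and v: "v \<in> vars f"
  shows "weight_var c v \<le> weight_var c (lead lt f)"
proof (rule ccontr)
  have r: "ranking lt" using lt by (simp add: weighted_ranking_def)
  assume "\<not> ?thesis"
  then have "lt (lead lt f) v" "v \<noteq> lead lt f"
    using lt unfolding weighted_ranking_def by (meson not_le, blast)
  then show False using lead_props(2)[OF r f v] r unfolding ranking_def by (metis irreflpD transpD)
qed

lemma weight_le_iff_lead:
  assumes "weighted_ranking c lt" and "f \<notin> ground"
  shows "weight_le c B f \<longleftrightarrow> int (weight_var c (lead lt f)) \<le> B"
proof
  assume "weight_le c B f"
  then show "int (weight_var c (lead lt f)) \<le> B"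
    using lead_props(1)[of lt f] assms unfolding weight_le_def weighted_ranking_def by blast
next
  assume "int (weight_var c (lead lt f)) \<le> B"
  then show "weight_le c B f"
    unfolding weight_le_def using weight_lead[OF assms] by (meson of_nat_le_iff order_trans)
qed

lemma weight_le_of_rank_le:
  assumes lt: "weighted_ranking c lt" and le: "rank_le lt g f" and f: "weight_le c B f"
  shows "weight_le c B g"
proof (cases "g \<in> ground")
  case True
  then show ?thesis by (simp add: weight_le_def flip: vars_eq_empty_iff)
next
  case False
  then have g: "f \<notin> ground" "lt (lead lt g) (lead lt f) \<or> lead lt g = lead lt f"
    using le by (auto simp: rank_le_def)
  have r: "irreflp lt" "transp lt" using lt by (auto simp: weighted_ranking_def ranking_def)
  have "\<not> lt (lead lt f) (lead lt g)" using g r by (metis irreflpD transpD)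
  then have "weight_var c (lead lt g) \<le> weight_var c (lead lt f)"
    using lt by (meson not_le weighted_ranking_def)
  then show ?thesis
    using f weight_le_iff_lead[OF lt False] weight_le_iff_lead[OF lt g(1)] by simp
qed

lemma vars_init: "vars (init lt f) \<subseteq> vars f"
  by (simp add: init_def vars_coeff_in)

lemma vars_sep: "vars (sep lt f) \<subseteq> vars f"
  by (simp add: sep_def vars_partial_deriv)

lemma vars_tails:
  assumes "ranking lt" and "f \<notin> ground"
  shows "vars (f - init lt f * rank lt f) \<subseteq> vars f"
    and "vars (of_nat k * f - Var (lead lt f) * sep lt f) \<subseteq> vars f"
proof -
  have "vars (rank lt f) \<subseteq> vars f" "vars (Var (lead lt f) :: ('a, 'b, 'c) dpoly) \<subseteq> vars f"
    using vars_power[of "Var (lead lt f) :: ('a, 'b, 'c) dpoly" "lead_deg lt f"] lead_props(1)[OF assms]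
    unfolding rank_def vars_Var by blast+
  then show "vars (f - init lt f * rank lt f) \<subseteq> vars f"
    and "vars (of_nat k * f - Var (lead lt f) * sep lt f) \<subseteq> vars f"
    by (intro order_trans[OF vars_diff] order_trans[OF vars_mult] Un_least order_refl vars_init
        vars_sep; simp)+
qed

text \<open>Each derivation operator lifts the leader exactly to the least common derivative, and
  separants add no derivatives. The indeterminate \<open>y\<close> merely completes the exponent
  vector and has no influence on the weight.\<close>

lemma weight_le_delta_poly:
  fixes f g :: "('m::finite, 'n, 'k::field) dpoly"
  assumes d: "differential_field d" and lt: "weighted_ranking c lt"
    and fg: "f \<notin> ground" "g \<notin> ground" "snd (lead lt f) = snd (lead lt g)"
  shows "weight_le c (int (weight_var c (lcd_exp (lead lt f) (lead lt g), y))) (delta_poly d lt f g)"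
proof -
  let ?u = "lead lt f" and ?v = "lead lt g"
  let ?B = "int (weight_var c (lcd_exp ?u ?v, y))"
  have w: "weight_var c u + (\<Sum>i\<in>UNIV. c i * (lcd_exp ?u ?v i - fst u i)) = weight_var c (lcd_exp ?u ?v, y)"
    if "u = ?u \<or> u = ?v" for u
    unfolding weight_var_def sum.distrib[symmetric]
  proof (rule sum.cong)
    fix i
    have "fst u i \<le> lcd_exp ?u ?v i" using that by (auto simp: lcd_exp_def)
    then show "c i * fst u i + c i * (lcd_exp ?u ?v i - fst u i) = c i * fst (lcd_exp ?u ?v, y) i"
      by (simp flip: distrib_left)
  qed simp
  have theta: "weight_le c ?B (theta_poly d (\<lambda>i. lcd_exp ?u ?v i - fst (lead lt p) i) p)"
    and sep: "weight_le c ?B (sep lt p)" if p: "p = f \<or> p = g" for p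
  proof -
    have ng: "p \<notin> ground" using p fg by blast
    have eq: "int (weight_var c (lead lt p)) +
        int (\<Sum>i\<in>UNIV. c i * (lcd_exp ?u ?v i - fst (lead lt p) i)) = ?B"
      unfolding of_nat_add[symmetric] of_nat_eq_iff using p by (intro w) auto
    have le: "weight_le c (int (weight_var c (lead lt p))) p"
      using weight_le_iff_lead[OF lt ng] by simp
    show "weight_le c ?B (theta_poly d (\<lambda>i. lcd_exp ?u ?v i - fst (lead lt p) i) p)"
      using weight_le_theta_poly[OF d le, of "\<lambda>i. lcd_exp ?u ?v i - fst (lead lt p) i"]
      unfolding eq .
    have "int (weight_var c (lead lt p)) \<le> ?B" using eq by linarith
    then show "weight_le c ?B (sep lt p)"
      using le by (meson weight_le_mono weight_le_vars_subset vars_sep)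
  qed
  show ?thesis
    using fg(3) theta sep by (auto simp: delta_poly_def Let_def intro!: weight_le_diff weight_le_mult)
qed

text \<open>Proper derivatives of \<open>lead lt a\<close> do not occur in \<open>q\<close>, but the
  leaders may coincide with a smaller degree in \<open>q\<close>. Reduction enters the stage lemmas
  in this form.\<close>

lemma reduced_lead:
  assumes "ranking lt" and "q \<notin> ground" and "reduced lt q a" and "below (lead lt a) (lead lt q)"
  shows "lead lt q = lead lt a"
proof -
  obtain \<theta> where \<theta>: "lead lt q = theta_var \<theta> (lead lt a)"
    using assms(4) below_iff_theta_var by blast
  then have "\<theta> = (\<lambda>_. 0)"
    using assms(3) lead_props(1)[OF assms(1,2)] unfolding reduced_def partially_reduced_def by metis
  then show ?thesis using \<theta> by simp
qed

text \<open>Of two distinct derivatives, one is reduced with respect to the other exactly when it is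
  not a derivative of it; autoreducedness of the leaders thus becomes an antichain
  condition.\<close>

lemma weak_d_triangular_iff:
  "weak_d_triangular lt (A :: ('m, 'n, 'k::comm_ring_1) dpoly set) \<longleftrightarrow>
     A \<inter> ground = {} \<and> inj_on (lead lt) A \<and>
     (\<forall>p\<in>leaders lt A. \<forall>q\<in>leaders lt A. below p q \<longrightarrow> p = q)"
proof -
  have inj: "Var u = (Var v :: ('m, 'n, 'k) dpoly) \<longleftrightarrow> u = v" for u v
    by (metis lead_Var)
  have red: "reduced lt (Var q :: ('m, 'n, 'k) dpoly) (Var p) \<longleftrightarrow> \<not> below p q"
    if "p \<noteq> q" for p q
  proof -
    have "partially_reduced lt (Var q :: ('m, 'n, 'k) dpoly) (Var p) \<longleftrightarrow> \<not> below p q"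
      using that unfolding partially_reduced_def below_iff_theta_var
      by (auto simp del: split_paired_All) (metis theta_var_0)
    moreover have "deg_in p (Var q :: ('m, 'n, 'k) dpoly) < deg_in p (Var p :: ('m, 'n, 'k) dpoly)"
      using that by (simp add: deg_in_eq_0 deg_in_pos)
    ultimately show ?thesis by (simp add: reduced_def)
  qed
  show ?thesis
    unfolding weak_d_triangular_def autoreduced_def
    using red by (auto simp: Var_notin_ground inj)
qed

section \<open>Partial autoreduction\<close>

text \<open>The definite description in \<open>by_leader\<close> needs a unique list. The order laws
  are required on \<open>A\<close> only, as leaders separate polynomials only there.\<close>

lemma ex1_strictly_sorted:
  assumes "finite A" and irrefl: "\<And>a. a \<in> A \<Longrightarrow> \<not> R a a"
    and trans: "\<And>a b e. a \<in> A \<Longrightarrow> b \<in> A \<Longrightarrow> e \<in> A \<Longrightarrow> R a b \<Longrightarrow> R b e \<Longrightarrow> R a e"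
    and total: "\<And>a b. a \<in> A \<Longrightarrow> b \<in> A \<Longrightarrow> a \<noteq> b \<Longrightarrow> R a b \<or> R b a"
  shows "\<exists>!xs. set xs = A \<and> sorted_wrt R xs"
proof (rule ex_ex1I)
  show "\<exists>xs. set xs = A \<and> sorted_wrt R xs"
    using assms
  proof (induction A rule: finite_induct)
    case (insert x A)
    then obtain xs where xs: "set xs = A" "sorted_wrt R xs" by blast
    have right: "R x z" if "z \<in> A" "\<not> R z x" for z
      using insert.prems(3)[of x z] insert.hyps that by auto
    then have across: "R y z" if "y \<in> A" "R y x" "z \<in> A" "\<not> R z x" for y z
      using insert.prems(2)[of y x z] that by blast
    have "sorted_wrt R (filter (\<lambda>y. R y x) xs)" "sorted_wrt R (filter (\<lambda>y. \<not> R y x) xs)"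
      using xs(2) by (auto intro: sorted_wrt_filter)
    then have "sorted_wrt R (filter (\<lambda>y. R y x) xs @ x # filter (\<lambda>y. \<not> R y x) xs)"
      unfolding sorted_wrt_append sorted_wrt.simps set_filter list.set xs(1)
      using right across by blast
    moreover have "set (filter (\<lambda>y. R y x) xs @ x # filter (\<lambda>y. \<not> R y x) xs) = insert x A"
      using xs by auto
    ultimately show ?case by blast
  qed (simp add: exI[of _ "[]"])
next
  have unique: "xs = ys" if "set xs \<subseteq> A" "set xs = set ys" "sorted_wrt R xs" "sorted_wrt R ys" for xs ys
    using that
  proof (induction xs arbitrary: ys)
    case (Cons x xs)
    then obtain y ys' where ys: "ys = y # ys'" by (cases ys) auto
    have A: "x \<in> A" "y \<in> A" using Cons.prems(1,2) ys by auto
    have "x = y"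
    proof (rule ccontr)
      assume "x \<noteq> y"
      then have "x \<in> set ys'" "y \<in> set xs" using Cons.prems(2) ys by auto
      then have "R x y" "R y x" using Cons.prems(3,4) ys by auto
      then show False using irrefl trans A by blast
    qed
    moreover have "x \<notin> set xs" "y \<notin> set ys'" using Cons.prems(3,4) ys irrefl A by auto
    ultimately have "set xs = set ys'" using Cons.prems(2) ys by auto
    then have "xs = ys'" using Cons.prems ys by (intro Cons.IH) auto
    with ys \<open>x = y\<close> show ?case by simp
  qed simp
  show "xs = ys" if "set xs = A \<and> sorted_wrt R xs" "set ys = A \<and> sorted_wrt R ys" for xs ys
    using that by (intro unique) auto
qed

lemma by_leader_props:
  assumes lt: "ranking lt" and "finite A" and inj: "inj_on (lead lt) A"
  shows "set (by_leader lt A) = A" and "distinct (map (lead lt) (by_leader lt A))"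
proof -
  have lt': "irreflp lt" "transp lt" "totalp lt" using lt by (auto simp: ranking_def)
  have "\<exists>!as. set as = A \<and> sorted_wrt (\<lambda>a b. lt (lead lt a) (lead lt b)) as"
  proof (rule ex1_strictly_sorted[OF assms(2)])
    fix a b
    assume "a \<in> A" "b \<in> A" "a \<noteq> b"
    then have "lead lt a \<noteq> lead lt b" using inj by (auto dest: inj_onD)
    then show "lt (lead lt a) (lead lt b) \<or> lt (lead lt b) (lead lt a)"
      using lt'(3) by (simp add: totalpD)
  qed (use lt' in \<open>auto dest: irreflpD transpD\<close>)
  from theI'[OF this] have *: "set (by_leader lt A) = A"
      "sorted_wrt (\<lambda>a b. lt (lead lt a) (lead lt b)) (by_leader lt A)"
    by (auto simp: by_leader_def)
  then show "set (by_leader lt A) = A" by blast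
  have "sorted_wrt lt (map (lead lt) (by_leader lt A))" using *(2) by (simp add: sorted_wrt_map)
  moreover have "sorted_wrt lt us \<Longrightarrow> distinct us" for us
    using lt'(1) by (induction us) (auto dest: irreflpD)
  ultimately show "distinct (map (lead lt) (by_leader lt A))" by blast
qed

text \<open>Equal ranks give equal leaders, so all leaders stay in the antichain \<open>P\<close>.
  Hence \<open>B\<close> remains weak d-triangular, which the specification of \<open>pd_red\<close>
  presupposes.\<close>

lemma apr_loop_weight_le:
  assumes lt: "weighted_ranking c lt" and pd: "pd_reduction d lt pd_red"
    and P: "\<And>p q. p \<in> P \<Longrightarrow> q \<in> P \<Longrightarrow> below p q \<Longrightarrow> p = q"
  shows "apr_loop lt pd_red as B = Some B' \<Longrightarrow> distinct (map (lead lt) as) \<Longrightarrow>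
    lead lt ` set as \<inter> lead lt ` B = {} \<Longrightarrow> lead lt ` (set as \<union> B) \<subseteq> P \<Longrightarrow>
    weak_d_triangular lt B \<Longrightarrow> (\<And>g. g \<in> set as \<union> B \<Longrightarrow> weight_le c N g) \<Longrightarrow>
    weak_d_triangular lt B' \<and> (\<forall>g\<in>B'. weight_le c N g)"
proof (induction as arbitrary: B)
  case (Cons a as)
  have r: "ranking lt" using lt by (simp add: weighted_ranking_def)
  let ?b = "pd_red a B"
  have b: "?b \<notin> ground" "rank lt ?b = rank lt a" and
    loop: "apr_loop lt pd_red as (B \<union> {?b}) = Some B'"
    using Cons.prems(1) by (auto simp: Let_def split: if_splits)
  have lead: "lead lt ?b = lead lt a" by (rule lead_eq_of_rank_eq[OF r b])
  have "rank_le lt ?b a" using pd Cons.prems(5) by (simp add: pd_reduction_def)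
  then have wb: "weight_le c N ?b" using lt Cons.prems(6)[of a] by (auto intro: weight_le_of_rank_le)
  have B: "B \<inter> ground = {}" "inj_on (lead lt) B" using Cons.prems(5) by (auto simp: weak_d_triangular_iff)
  have "lead lt a \<notin> lead lt ` B" using Cons.prems(3) by auto
  then have "weak_d_triangular lt (B \<union> {?b})"
    using B b(1) lead P Cons.prems(4)
    by (auto simp: weak_d_triangular_iff leaders_def image_subset_iff)
  then show ?case
    using Cons.prems wb lead by (intro Cons.IH[OF loop]) auto
qed auto

lemma auto_partial_reduce_weight_le:
  assumes lt: "weighted_ranking c lt" and pd: "pd_reduction d lt pd_red"
    and A: "weak_d_triangular lt A" "finite A" and w: "\<And>g. g \<in> A \<union> H \<Longrightarrow> weight_le c N g"
    and out: "(B, K) \<in> auto_partial_reduce lt pd_red A H" and g: "g \<in> B \<union> K"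
  shows "weight_le c N g"
proof -
  have r: "ranking lt" using lt by (simp add: weighted_ranking_def)
  have loop: "apr_loop lt pd_red (by_leader lt A) {} = Some B" and
    K: "K = inits_seps lt B \<union> {pd_red q B | q. q \<in> H - inits_seps lt A}"
    using out by (auto simp: auto_partial_reduce_def Let_def split: option.splits if_splits)
  have A': "inj_on (lead lt) A" "\<And>p q. p \<in> leaders lt A \<Longrightarrow> q \<in> leaders lt A \<Longrightarrow> below p q \<Longrightarrow> p = q"
    using A(1) by (auto simp: weak_d_triangular_iff)
  have "weak_d_triangular lt B \<and> (\<forall>g\<in>B. weight_le c N g)"
    using by_leader_props[OF r A(2) A'(1)] w
    by (intro apr_loop_weight_le[OF lt pd A'(2) loop])
      (auto simp: leaders_def weak_d_triangular_iff)
  then have B: "weak_d_triangular lt B" "\<And>g. g \<in> B \<Longrightarrow> weight_le c N g" by auto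
  have "weight_le c N (pd_red q B)" if "q \<in> H" for q
    using pd B(1) w[of q] that lt by (auto simp: pd_reduction_def intro: weight_le_of_rank_le)
  moreover have "weight_le c N g" if "g \<in> inits_seps lt B" for g
    using that B(2) by (auto simp: inits_seps_def
        intro: weight_le_vars_subset[OF _ vars_init] weight_le_vars_subset[OF _ vars_sep])
  ultimately show ?thesis using g K B(2) by auto
qed


section \<open>The invariant of a branch\<close>

text \<open>
  The weight of \<open>\<Delta>(f, g)\<close> is bounded by that of the least common derivative of two leaders,
  which may exceed the bound of the current stage. The stage is adapted only
  when the polynomial has been reduced.
\<close>

definition critical ::
    "('m \<Rightarrow> nat) \<Rightarrow> ('m::finite, 'n) dvar set \<Rightarrow> ('m, 'n, 'k::comm_ring_1) dpoly \<Rightarrow> bool" where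
  "critical c V p \<longleftrightarrow> (\<exists>u\<in>V. \<exists>v\<in>V. snd u = snd v \<and> \<not> below u v \<and> \<not> below v u \<and>
     weight_le c (int (weight_var c (lcd_exp u v, snd u))) p)"

text \<open>\<open>V\<close> is kept apart from \<open>A\<close>: it retains leaders already removed
  from \<open>A\<close>, to which pending \<Delta>-polynomials may still refer.\<close>

definition branch_inv ::
    "('m \<Rightarrow> nat) \<Rightarrow> (('m, 'n) dvar \<Rightarrow> ('m, 'n) dvar \<Rightarrow> bool) \<Rightarrow> nat \<Rightarrow> nat \<Rightarrow> nat set \<Rightarrow>
     (nat \<Rightarrow> ('m::finite, 'n::finite) dvar list) \<Rightarrow> ('m, 'n) dvar set \<Rightarrow>
     ('m, 'n, 'k::comm_ring_1) rg_tuple \<Rightarrow> bool" where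
  "branch_inv c lt h K E C V = (\<lambda>(G, D, A, H).
     weak_d_triangular lt A \<and> finite A \<and> stage c h K E C V (leaders lt A) \<and>
     (\<forall>g\<in>G \<union> A \<union> H. weight_le c (bnd h E (K + 1)) g) \<and> (\<forall>p\<in>D. critical c V p))"

text \<open>An element of \<open>G\<close> already obeys the bound. For one of \<open>D\<close>,
  \<open>stage_reach\<close> advances \<open>K\<close>, \<open>E\<close> and \<open>C\<close> until
  the leader of the reduced polynomial fits, while the tuple and \<open>V\<close> stay
  fixed.\<close>

lemma branch_inv_reduce:
  fixes A :: "('m::finite, 'n::finite, 'k::field_char_0) dpoly set"
  assumes lt: "weighted_ranking c lt" and c: "\<forall>i. 0 < c i" and dr: "d_reduction d lt d_red"
    and inv: "branch_inv c lt h K E C V (G, D, A, H)" and p: "p \<in> G \<union> D" and q: "d_red p A \<notin> ground"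
    and bounded: "\<And>K E C. stage c h K E C V (leaders lt A) \<Longrightarrow> K \<le> L"
  shows "\<exists>K E C. branch_inv c lt h K E C V (G, D, A, H) \<and> weight_le c (bnd h E (K + 1)) (d_red p A)"
proof -
  let ?q = "d_red p A"
  have r: "ranking lt" using lt by (simp add: weighted_ranking_def)
  have A: "weak_d_triangular lt A" and st: "stage c h K E C V (leaders lt A)"
    and w: "\<And>g. g \<in> G \<union> A \<union> H \<Longrightarrow> weight_le c (bnd h E (K + 1)) g"
    and D: "\<And>p. p \<in> D \<Longrightarrow> critical c V p"
    using inv by (auto simp: branch_inv_def)
  have red: "\<And>a. a \<in> A \<Longrightarrow> reduced lt ?q a" and le: "rank_le lt ?q p"
    using dr A by (auto simp: d_reduction_def)
  show ?thesis
  proof (cases "p \<in> G")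
    case True
    then have "weight_le c (bnd h E (K + 1)) ?q"
      using w[of p] by (intro weight_le_of_rank_le[OF lt le]) auto
    then show ?thesis using inv by blast
  next
    case False
    then have "critical c V p" using p D by blast
    then obtain u v where uv: "u \<in> V" "v \<in> V" "snd u = snd v" "\<not> below u v" "\<not> below v u"
      and "weight_le c (int (weight_var c (lcd_exp u v, snd u))) p"
      unfolding critical_def by blast
    then have "weight_le c (int (weight_var c (lcd_exp u v, snd u))) ?q"
      by (intro weight_le_of_rank_le[OF lt le])
    then have z: "weight_var c (lead lt ?q) \<le> weight_var c (lcd_exp u v, snd u)"
      using weight_le_iff_lead[OF lt q] by simp
    have redz: "\<And>x. x \<in> leaders lt A \<Longrightarrow> below x (lead lt ?q) \<Longrightarrow> lead lt ?q = x"
      using reduced_lead[OF r q red] by (auto simp: leaders_def)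
    have "\<exists>K' E' C'. stage c h K' E' C' V (leaders lt A) \<and> bnd h E (K + 1) \<le> bnd h E' (K' + 1) \<and>
        int (weight_var c (lead lt ?q)) \<le> bnd h E' (K' + 1)"
      by (rule stage_reach[OF st c _ uv z]) (use redz bounded in blast)+
    then obtain K' E' C' where new: "stage c h K' E' C' V (leaders lt A)"
      "bnd h E (K + 1) \<le> bnd h E' (K' + 1)" "int (weight_var c (lead lt ?q)) \<le> bnd h E' (K' + 1)"
      by blast
    then have "weight_le c (bnd h E' (K' + 1)) g" if "g \<in> G \<union> A \<union> H" for g
      using w[OF that] weight_le_mono by blast
    then have "branch_inv c lt h K' E' C' V (G, D, A, H)"
      using inv new(1) by (auto simp: branch_inv_def)
    then show ?thesis using new(3) weight_le_iff_lead[OF lt q] by blast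
  qed
qed

lemma branch_inv_update:
  fixes A :: "('m::finite, 'n::finite, 'k::field_char_0) dpoly set"
  assumes d: "differential_field d" and lt: "weighted_ranking c lt"
    and inv: "branch_inv c lt h K E C V (G, D, A, H)"
    and q: "q \<notin> ground" "\<And>a. a \<in> A \<Longrightarrow> reduced lt q a" "weight_le c (bnd h E (K + 1)) q"
  shows "branch_inv c lt h K E C (insert (lead lt q) V) (rg_update d lt G D A H q)"
proof -
  let ?z = "lead lt q"
  define B where "B = {a \<in> A. below ?z (lead lt a)}"
  have r: "ranking lt" using lt by (simp add: weighted_ranking_def)
  have A: "A \<inter> ground = {}" "inj_on (lead lt) A" "finite A"
      "\<And>x y. x \<in> leaders lt A \<Longrightarrow> y \<in> leaders lt A \<Longrightarrow> below x y \<Longrightarrow> x = y"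
    and st: "stage c h K E C V (leaders lt A)"
    and w: "\<And>g. g \<in> G \<union> A \<union> H \<Longrightarrow> weight_le c (bnd h E (K + 1)) g"
    and D: "\<And>p. p \<in> D \<Longrightarrow> critical c V p"
    using inv by (auto simp: branch_inv_def weak_d_triangular_iff)
  have red: "?z = x" if "x \<in> leaders lt A" "below x ?z" for x
    using that reduced_lead[OF r q(1) q(2)] by (auto simp: leaders_def)
  have upd: "rg_update d lt G D A H q =
      (G \<union> B, (D \<union> delta_poly d lt q ` (A - B)) - {0}, A - B \<union> {q}, H \<union> {sep lt q, init lt q})"
    unfolding rg_update_def Let_def B_def below_iff_theta_var by simp
  have leads: "leaders lt (A - B \<union> {q}) = insert ?z {x \<in> leaders lt A. \<not> below ?z x}"
    by (auto simp: leaders_def B_def)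
  \<comment> \<open>The leaders above \<open>?z\<close> have gone into \<open>B\<close>, and one
    below \<open>?z\<close> would equal it by reducedness.\<close>
  have incomp: "\<not> below ?z (lead lt a) \<and> \<not> below (lead lt a) ?z" if a: "a \<in> A - B" for a
    using a red[of "lead lt a"] below_refl[of ?z] by (auto simp: B_def leaders_def)
  have "weak_d_triangular lt (A - B \<union> {q})"
    unfolding weak_d_triangular_iff
  proof (intro conjI)
    show "inj_on (lead lt) (A - B \<union> {q})"
    proof -
      have "?z \<notin> lead lt ` (A - B)" using incomp below_refl[of ?z] by (metis imageE)
      moreover have "inj_on (lead lt) (A - B)" using A(2) by (rule inj_on_subset) blast
      ultimately show ?thesis by (simp add: inj_on_insert image_iff)
    qed
    show "\<forall>x\<in>leaders lt (A - B \<union> {q}). \<forall>y\<in>leaders lt (A - B \<union> {q}). below x y \<longrightarrow> x = y"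
      unfolding leads using A(4) red by blast
  qed (use A(1) q(1) in auto)
  moreover have "stage c h K E C (insert ?z V) (leaders lt (A - B \<union> {q}))"
    unfolding leads
  proof (rule stage_insert[OF st])
    show "int (weight_var c ?z) \<le> bnd h E (K + 1)"
      using weight_le_iff_lead[OF lt q(1)] q(3) by blast
  qed (rule red)
  moreover have "weight_le c (bnd h E (K + 1)) g"
    if g: "g \<in> (G \<union> B) \<union> (A - B \<union> {q}) \<union> (H \<union> {sep lt q, init lt q})" for g
  proof -
    consider "g \<in> G \<union> A \<union> H" | "g = q" | "g = sep lt q" | "g = init lt q"
      using g unfolding B_def by blast
    then show ?thesis
      using w q(3) weight_le_vars_subset[OF q(3) vars_sep] weight_le_vars_subset[OF q(3) vars_init]
      by cases auto
  qed
  moreover have "critical c (insert ?z V) p" if p: "p \<in> (D \<union> delta_poly d lt q ` (A - B)) - {0}" for p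
  proof (cases "p \<in> D")
    case True
    then show ?thesis using D by (auto simp: critical_def)
  next
    case False
    then obtain a where a: "a \<in> A - B" "p = delta_poly d lt q a" "p \<noteq> 0" using p by blast
    \<comment> \<open>For different indeterminates the \<Delta>-polynomial is 0 by definition, and
      zeros are discarded by the update.\<close>
    then have s: "snd ?z = snd (lead lt a)" by (auto simp: delta_poly_def Let_def split: if_splits)
    have "a \<notin> ground" using a(1) A(1) by auto
    then have "weight_le c (int (weight_var c (lcd_exp ?z (lead lt a), snd ?z))) p"
      unfolding a(2) by (rule weight_le_delta_poly[OF d lt q(1) _ s])
    moreover have "lead lt a \<in> V" using a(1) stageD(1)[OF st] by (auto simp: leaders_def)
    ultimately show ?thesis using s incomp[OF a(1)] unfolding critical_def by blast
  qed
  ultimately show ?thesis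
    unfolding upd branch_inv_def using A(3) by simp
qed

section \<open>The steps of the algorithm preserve the invariant\<close>

lemma branch_inv_subset:
  assumes "branch_inv c lt h K E C V (G, D, A, H)" and "D' \<subseteq> D"
    and "\<And>g. g \<in> G' \<union> H' \<Longrightarrow> g \<in> G \<union> H \<or> weight_le c (bnd h E (K + 1)) g"
  shows "branch_inv c lt h K E C V (G', D', A, H')"
  using assms unfolding branch_inv_def by blast

text \<open>\<open>N\<close> bounds the weights of every possible stage, so each branch may finish
  at a stage of its own.\<close>

lemma rg_step_invariant:
  fixes S S' :: "('m::finite, 'n::finite, 'k::field_char_0) rg_tuple set"
  assumes d: "differential_field d" and lt: "weighted_ranking c lt" and c: "\<forall>i. 0 < c i"
    and pd: "pd_reduction d lt pd_red" and dr: "d_reduction d lt d_red"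
    and length: "\<And>K E C (V :: ('m, 'n) dvar set) P. stage c h K E C V P \<Longrightarrow> K \<le> L"
    and bound: "\<And>K E C (V :: ('m, 'n) dvar set) P. stage c h K E C V P \<Longrightarrow> bnd h E (K + 1) \<le> N"
    and step: "rg_step d lt pd_red d_red (S, \<A>) (S', \<A>')"
    and S: "\<And>T. T \<in> S \<Longrightarrow> \<exists>K E C V. branch_inv c lt h K E C V T"
    and out: "\<And>A H g. (A, H) \<in> \<A> \<Longrightarrow> g \<in> A \<union> H \<Longrightarrow> weight_le c N g"
  shows "(\<forall>T\<in>S'. \<exists>K E C V. branch_inv c lt h K E C V T) \<and>
    (\<forall>(A, H)\<in>\<A>'. \<forall>g\<in>A \<union> H. weight_le c N g)"
  using step
proof cases
  case (finish G D A H)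
  then obtain K E C V where inv: "branch_inv c lt h K E C V (G, D, A, H)" using S by blast
  then have A: "weak_d_triangular lt A" "finite A" and N: "bnd h E (K + 1) \<le> N"
    and w: "\<And>g. g \<in> A \<union> H \<Longrightarrow> weight_le c (bnd h E (K + 1)) g"
    using bound by (auto simp: branch_inv_def)
  have "weight_le c N g" if "g \<in> A \<union> H" for g using weight_le_mono[OF w[OF that] N] .
  note new = auto_partial_reduce_weight_le[OF lt pd A this]
  have "weight_le c N g" if "(B, M) \<in> \<A>'" "g \<in> B \<union> M" for B M g
    using that new out unfolding finish(2) by blast
  moreover have "\<exists>K E C V. branch_inv c lt h K E C V T" if "T \<in> S'" for T
    using that S unfolding finish(1) by blast
  ultimately show ?thesis by blast
next
  case (zero G D A H p)
  then obtain K E C V where "branch_inv c lt h K E C V (G, D, A, H)" using S by blast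
  then have "branch_inv c lt h K E C V (G - {p}, D - {p}, A, H)"
    by (rule branch_inv_subset) auto
  then have "\<exists>K E C V. branch_inv c lt h K E C V T" if "T \<in> S'" for T
    using that S unfolding zero(1) by blast
  then show ?thesis using out unfolding zero(2) by blast
next
  case (nonzero_ground G D A H p)
  have "\<exists>K E C V. branch_inv c lt h K E C V T" if "T \<in> S'" for T
    using that S unfolding nonzero_ground(1) by blast
  then show ?thesis using out unfolding nonzero_ground(2) by blast
next
  case (split G D A H p q qi qs)
  have r: "ranking lt" using lt by (simp add: weighted_ranking_def)
  obtain K0 E0 C0 V where "branch_inv c lt h K0 E0 C0 V (G, D, A, H)" using S split(3) by blast
  \<comment> \<open>The stage is advanced before the three successors are formed. Then
    \<open>q\<close> fits, and so do its initial, separant and tails, which involve only derivatives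
    occurring in \<open>q\<close>.\<close>
  then have "\<exists>K E C. branch_inv c lt h K E C V (G, D, A, H) \<and> weight_le c (bnd h E (K + 1)) (d_red p A)"
    by (rule branch_inv_reduce[OF lt c dr _ split(4), where L = L]) (use split(5,6) length in blast)+
  then obtain K E C where inv: "branch_inv c lt h K E C V (G, D, A, H)"
    and q: "weight_le c (bnd h E (K + 1)) q"
    unfolding split(5) by blast
  have red: "reduced lt q a" if "a \<in> A" for a
    using inv dr split(5) that by (auto simp: branch_inv_def d_reduction_def)
  have parts: "weight_le c (bnd h E (K + 1)) g" if "g \<in> {qi, qs, init lt q, sep lt q}" for g
  proof (rule weight_le_vars_subset[OF q])
    show "vars g \<subseteq> vars q"
      using that vars_tails[OF r split(6)] vars_init[of lt q] vars_sep[of lt q] split(7,8) by auto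
  qed
  have "branch_inv c lt h K E C V (G - {p}, D - {p}, A, H)"
    using inv by (rule branch_inv_subset) auto
  from branch_inv_update[OF d lt this split(6) red q]
  have 1: "branch_inv c lt h K E C (insert (lead lt q) V) (rg_update d lt (G - {p}) (D - {p}) A H q)"
    by blast
  have 2: "branch_inv c lt h K E C V ((G - {p}) \<union> {qs, sep lt q}, D - {p}, A, H \<union> {init lt q})"
    using inv by (rule branch_inv_subset) (use parts in auto)
  have 3: "branch_inv c lt h K E C V ((G - {p}) \<union> {qi, init lt q}, D - {p}, A, H)"
    using inv by (rule branch_inv_subset) (use parts in auto)
  have "\<exists>K E C V. branch_inv c lt h K E C V T" if "T \<in> S'" for T
    using that S 1 2 3 unfolding split(1) by blast
  then show ?thesis using out unfolding split(2) by blast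
qed

lemma weight_le_max_weight:
  assumes "finite X" and "g \<in> X"
  shows "weight_le c (int (max_weight c X)) g"
  unfolding weight_le_def
proof
  fix v
  assume "v \<in> vars g"
  then have "weight_var c v \<le> weight_poly c g"
    unfolding weight_poly_def by (intro Max_ge) auto
  also have "\<dots> \<le> max_weight c X"
    unfolding max_weight_def using assms by (intro Max_ge) auto
  finally show "int (weight_var c v) \<le> int (max_weight c X)" by simp
qed

theorem corollary30:
  fixes d :: "'m::finite \<Rightarrow> 'k::field_char_0 \<Rightarrow> 'k"
    and c :: "'m \<Rightarrow> nat"
    and lt :: "('m, 'n::finite) dvar \<Rightarrow> ('m, 'n) dvar \<Rightarrow> bool"
    and pd_red d_red :: "('m, 'n, 'k) dpoly \<Rightarrow> ('m, 'n, 'k) dpoly set \<Rightarrow> ('m, 'n, 'k) dpoly"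
    and F K :: "('m, 'n, 'k) dpoly set"
    and \<A> :: "(('m, 'n, 'k) dpoly set \<times> ('m, 'n, 'k) dpoly set) set"
    and f :: "nat \<Rightarrow> int" and h L :: nat
  assumes "CARD('m) \<ge> 2"
    and "differential_field d"
    and "finite F" and "finite K"
    and "h = max_ord (F \<union> K)"
    and "\<forall>i. c i > 0"
    and "max_weight c (F \<union> K) = max_ord (F \<union> K)"
    and "weighted_ranking c lt"
    and "pd_reduction d lt pd_red" and "d_reduction d lt d_red"
    and "f = (\<lambda>i. if CARD('m) = 2 then fib_bound CARD('n) h i else int (h * fib i))"
    and "L = max_antichain_length TYPE('m) TYPE('n) f"
    and "Rosenfeld_Groebner d lt pd_red d_red F K \<A>"
  shows "\<forall>(A, H)\<in>\<A>. \<forall>g\<in>A \<union> H. \<forall>i.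
    real (ord_wrt i g) \<le>
      (if CARD('m) = 2 then real_of_int (fib_bound CARD('n) h (L + 1)) / real (c i)
       else real (h * fib (L + 1)) / real (c i))"
proof -
  have f: "f = bnd h (if CARD('m) = 2 then {..CARD('n) + 1} else UNIV)"
    unfolding assms(11) by (auto simp: fib_bound_eq_bnd fib_eq_bnd simp del: of_nat_mult)
  note bounds = stage_bounds[OF _ assms(6) f, folded assms(12)]
  define N where "N = f (L + 1)"
  have N: "bnd h E (k + 1) \<le> N" if "stage c h k E C V P" for k E C and V P :: "('m, 'n) dvar set"
    unfolding N_def using bounds(2)[OF that] .
  let ?E = "if CARD('m) = 2 then {} else UNIV :: nat set"
  have st: "stage c h 0 ?E (\<lambda>_. []) {} ({} :: ('m, 'n) dvar set)" by (rule stage_initial)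
  have "0 \<le> N" using N[OF st] by simp
  define good where "good = (\<lambda>(S :: ('m, 'n, 'k) rg_tuple set,
      \<A> :: (('m, 'n, 'k) dpoly set \<times> ('m, 'n, 'k) dpoly set) set). (\<forall>T\<in>S. \<exists>k E C V. branch_inv c lt h k E C V T) \<and>
    (\<forall>(A, H)\<in>\<A>. \<forall>g\<in>A \<union> H. weight_le c N g))"
  have "(rg_step d lt pd_red d_red)\<^sup>*\<^sup>* ({(F, {}, {}, K)}, {}) ({}, \<A>)"
    using assms(13) by (simp add: Rosenfeld_Groebner_def)
  moreover have "good ({(F, {}, {}, K)}, {})"
  proof -
    have "weight_le c (int h) g" if "g \<in> F \<union> K" for g
      using weight_le_max_weight[of "F \<union> K" g c] that assms(3,4,5,7) by simp
    \<comment> \<open>At stage 0 the bound is \<open>bnd h ?E 1 = h\<close>, which the input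
      satisfies because its maximal weight equals its maximal order.\<close>
    then have "branch_inv c lt h 0 ?E (\<lambda>_. []) {} (F, {}, {}, K)"
      using st by (simp add: branch_inv_def weak_d_triangular_iff leaders_def)
    then show ?thesis unfolding good_def by auto
  qed
  moreover have "good s'" if "rg_step d lt pd_red d_red s s'" "good s" for s s'
  proof -
    obtain S B S' B' where s: "s = (S, B)" "s' = (S', B')" by (cases s; cases s')
    have S: "\<And>T. T \<in> S \<Longrightarrow> \<exists>k E C V. branch_inv c lt h k E C V T"
      and B: "\<And>A H g. (A, H) \<in> B \<Longrightarrow> g \<in> A \<union> H \<Longrightarrow> weight_le c N g"
      using that(2) unfolding good_def s by blast+
    show ?thesis
      using rg_step_invariant[OF assms(2,8,6,9,10) bounds(1) N that(1)[unfolded s] S B]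
      unfolding good_def s by simp
  qed
  ultimately have "good ({}, \<A>)" by (induction rule: rtranclp_induct) auto
  then have "real (ord_wrt i g) \<le> real_of_int N / real (c i)" if "(A, H) \<in> \<A>" "g \<in> A \<union> H" for A H g i
    using that \<open>0 \<le> N\<close> assms(6) by (intro ord_wrt_le_weight) (auto simp: good_def)
  then show ?thesis unfolding N_def assms(11) by (auto split: if_splits)
qed

end
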